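(* There is an absolute constant $C>0$ such that the following holds for the single-resource, single-type online allocation problem described in the context. Let $\alpha\in(0,\frac18)$ be a constant such that $3\alpha+\frac{C\rho_{\max}}{\sigma_{\min}^3\sqrt{T}}<\frac12$. Then any online algorithm which achieves $\Delta_{EF}\le L_T$ with probability at least $1-\alpha$, where $L_T=o(1)$, must also incur, with probability at least $\frac1{12}-o(1)$, $$\Delta_{efficiency}\;\ge\;\tilde C\,\min\{\sqrt{T},\,1/L_T\},$$ where $$\tilde C=\left(\beta_{avg}-o(1)\right)^2\,\frac{\Phi^{-1}\!\left(1-3\alpha-\frac{C\rho_{\max}}{\sigma_{\min}^3\sqrt{T}}\right)^2\sigma_{\min}^2}{24\sqrt{2\rho_{\max}^2\log(T/\alpha)}\;\mu_{\max}} .$$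
   Context: Single-resource, single-type online allocation problem: a budget $B>0$ of one divisible resource is to be divided among individuals arriving over rounds $t=1,\dots,T$. In round $t$ a random number $N_t$ of individuals arrives, where $N_1,\dots,N_T$ are independent with known distributions, $N_t\ge 1$ almost surely, $\mathrm{Var}[N_t]=\sigma_t^2>0$, and $|N_t-\mathbb{E}[N_t]|\le\rho_t<\infty$ almost surely. Put $\sigma_{\min}=\min_t\sigma_t$, $\rho_{\max}=\max_t\rho_t$, $\mu_{\max}=\max_t\mathbb{E}[N_t]$, $N=\sum_{t=1}^T N_t$, and $\beta_{avg}=B/\mathbb{E}[N]$. An online algorithm chooses in each round $t$, after observing $N_1,\dots,N_t$ (but not later arrivals), an allocation $X_t^{alg}\ge 0$ given to each of the $N_t$ individuals of that round; decisions are irrevocable and must satisfy $\sum_{t=1}^T N_tX_t^{alg}\le B$. Each individual's utility equals the allocation received, $u(X)=X$. The optimal fair allocation in hindsight is $X^{opt}=B/N$ for every individual. The counterfactual envy is $\Delta_{EF}=\max_{t\in[T]}|X_t^{alg}-X^{opt}|$, and the waste (efficiency loss) is $\Delta_{efficiency}=B-\sum_{t=1}^T N_tX_t^{alg}$. $\Phi$ is the standard normal cumulative distribution function. Asymptotics: $o(1)$ denotes quantities tending to $0$ as $T\to\infty$, for a sequence of problem instances indexed by $T$ in which $\sigma_{\min},\rho_{\max},\mu_{\max},\beta_{avg}$ are regarded as constants. The convention $1/0=+\infty$ is used. *)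

theory Defs
  imports "HOL-Probability.Probability"
begin

text \<open>
  Rounds are numbered \<open>1, \<dots>, rounds P\<close>; the values of \<open>arrivals\<close> (the laws of the \<open>N\<^sub>t\<close>) and
  \<open>deviation\<close> (the bounds \<open>\<rho>\<^sub>t\<close>) outside this range are irrelevant.
\<close>

record allocation_problem =
  rounds :: nat
  budget :: real
  arrivals :: "nat \<Rightarrow> nat pmf"
  deviation :: "nat \<Rightarrow> real"

definition mean_arrivals :: "allocation_problem \<Rightarrow> nat \<Rightarrow> real" where
  "mean_arrivals P t = measure_pmf.expectation (arrivals P t) real"

definition var_arrivals :: "allocation_problem \<Rightarrow> nat \<Rightarrow> real" where
  "var_arrivals P t = measure_pmf.variance (arrivals P t) real"

text \<open>
  The last condition forces \<open>N\<^sub>t\<close> to be bounded, so that the mean and the variance above are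
  genuine ones (and not the default value 0 of a non-convergent integral).
\<close>

definition valid_problem :: "allocation_problem \<Rightarrow> bool" where
  "valid_problem P \<longleftrightarrow>
     rounds P \<ge> 1 \<and> budget P > 0 \<and>
     (\<forall>t\<in>{1..rounds P}.
        (AE n in measure_pmf (arrivals P t). n \<ge> 1) \<and>
        var_arrivals P t > 0 \<and>
        (AE n in measure_pmf (arrivals P t). \<bar>real n - mean_arrivals P t\<bar> \<le> deviation P t))"

definition sigma_min :: "allocation_problem \<Rightarrow> real" where
  "sigma_min P = Min ((\<lambda>t. sqrt (var_arrivals P t)) ` {1..rounds P})"

definition rho_max :: "allocation_problem \<Rightarrow> real" where
  "rho_max P = Max (deviation P ` {1..rounds P})"

definition mu_max :: "allocation_problem \<Rightarrow> real" where
  "mu_max P = Max (mean_arrivals P ` {1..rounds P})"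

text \<open>Joint law of the independent arrivals \<open>(N\<^sub>1, \<dots>, N\<^sub>T)\<close>.\<close>

definition arrivals_law :: "allocation_problem \<Rightarrow> (nat \<Rightarrow> nat) pmf" where
  "arrivals_law P = Pi_pmf {1..rounds P} 0 (arrivals P)"

definition total_arrivals :: "allocation_problem \<Rightarrow> (nat \<Rightarrow> nat) \<Rightarrow> real" where
  "total_arrivals P n = (\<Sum>t = 1..rounds P. real (n t))"

definition beta_avg :: "allocation_problem \<Rightarrow> real" where
  "beta_avg P = budget P / measure_pmf.expectation (arrivals_law P) (total_arrivals P)"

text \<open>
  A possibly randomized online algorithm consists of the law \<open>S\<close> of a random seed, independent of
  the arrivals, and of a function \<open>X\<close>: with seed \<open>s\<close>, after observing \<open>n\<^sub>1, \<dots>, n\<^sub>t\<close>, each individual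
  of round \<open>t\<close> receives \<open>X s [n\<^sub>1, \<dots>, n\<^sub>t]\<close>. Deterministic algorithms are those with \<open>X\<close> not
  depending on \<open>s\<close>. Outcomes are pairs \<open>(s, n)\<close> of a seed and an arrival sequence. The seed is
  real-valued (rather than of an arbitrary type) so that a constant quantified outside of all
  problems and algorithms does not depend on a type parameter.
\<close>

definition outcomes :: "allocation_problem \<Rightarrow> real measure \<Rightarrow> (real \<times> (nat \<Rightarrow> nat)) measure" where
  "outcomes P S = S \<Otimes>\<^sub>M measure_pmf (arrivals_law P)"

definition allocation ::
  "(real \<Rightarrow> nat list \<Rightarrow> real) \<Rightarrow> nat \<Rightarrow> real \<times> (nat \<Rightarrow> nat) \<Rightarrow> real" where
  "allocation X t \<omega> = X (fst \<omega>) (map (snd \<omega>) [1..<Suc t])"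

definition spent ::
  "allocation_problem \<Rightarrow> (real \<Rightarrow> nat list \<Rightarrow> real) \<Rightarrow> real \<times> (nat \<Rightarrow> nat) \<Rightarrow> real" where
  "spent P X \<omega> = (\<Sum>t = 1..rounds P. real (snd \<omega> t) * allocation X t \<omega>)"

definition online_algorithm ::
  "allocation_problem \<Rightarrow> real measure \<Rightarrow> (real \<Rightarrow> nat list \<Rightarrow> real) \<Rightarrow> bool" where
  "online_algorithm P S X \<longleftrightarrow>
     prob_space S \<and> sets S = sets borel \<and>
     (\<forall>h. (\<lambda>s. X s h) \<in> borel_measurable S) \<and>
     (AE \<omega> in outcomes P S.
        (\<forall>t\<in>{1..rounds P}. allocation X t \<omega> \<ge> 0) \<and> spent P X \<omega> \<le> budget P)"

definition hindsight_allocation :: "allocation_problem \<Rightarrow> real \<times> (nat \<Rightarrow> nat) \<Rightarrow> real" where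
  "hindsight_allocation P \<omega> = budget P / total_arrivals P (snd \<omega>)"

definition envy ::
  "allocation_problem \<Rightarrow> (real \<Rightarrow> nat list \<Rightarrow> real) \<Rightarrow> real \<times> (nat \<Rightarrow> nat) \<Rightarrow> real" where
  "envy P X \<omega> =
     Max ((\<lambda>t. \<bar>allocation X t \<omega> - hindsight_allocation P \<omega>\<bar>) ` {1..rounds P})"

definition waste ::
  "allocation_problem \<Rightarrow> (real \<Rightarrow> nat list \<Rightarrow> real) \<Rightarrow> real \<times> (nat \<Rightarrow> nat) \<Rightarrow> real" where
  "waste P X \<omega> = budget P - spent P X \<omega>"

definition Phi_inv :: "real \<Rightarrow> real" where
  "Phi_inv = inv (cdf std_normal_distribution)"

text \<open>\<open>min {\<surd>T, 1/l}\<close> with the convention \<open>1/0 = \<infinity>\<close>.\<close>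

definition min_sqrt_inverse :: "nat \<Rightarrow> real \<Rightarrow> real" where
  "min_sqrt_inverse T l = (if l = 0 then sqrt (real T) else min (sqrt (real T)) (1 / l))"

text \<open>\<open>z\<close> is the argument of \<open>\<Phi>\<^sup>-\<^sup>1\<close>, and \<open>e\<close> the \<open>o(1)\<close> term subtracted from \<open>\<beta>\<close>.\<close>

definition waste_coeff ::
  "nat \<Rightarrow> real \<Rightarrow> real \<Rightarrow> real \<Rightarrow> real \<Rightarrow> real \<Rightarrow> real \<Rightarrow> real \<Rightarrow> real" where
  "waste_coeff T \<alpha> \<sigma> \<rho> \<mu> \<beta> z e =
     (\<beta> - e)\<^sup>2 * ((Phi_inv z)\<^sup>2 * \<sigma>\<^sup>2 / (24 * sqrt (2 * \<rho>\<^sup>2 * ln (real T / \<alpha>)) * \<mu>))"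

end

theory Submission
  imports Defs "HOL-Real_Asymp.Real_Asymp"
begin

text \<open>
  Fix the seed and split the horizon into a history of \<open>T - k\<close> rounds and the last \<open>k \<le> T/2\<close> rounds,
  whose total arrivals \<open>S\<close> are independent of the history. Two continuations of one history with
  \<open>S\<close>-values \<open>a > b\<close> have the same spending before the split. If the envy is at most \<open>l\<close> on
  both, then feasibility on the first forces the algorithm to keep about \<open>a B / (N\<^sub>0 + a) - a l\<close> in
  reserve, of which at most \<open>b B / (N\<^sub>0 + b) + b l\<close> is spent on the second; so the second wastes at
  least of the order of \<open>\<beta> (a - b) - l k\<close>. An Esseen-type concentration inequality shows that \<open>S\<close> is
  above, and below, its median by \<open>c \<surd>k\<close> with probability at least \<open>1/3\<close> each. With \<open>k\<close> of the order
  of \<open>min {T, 1/l\<^sup>2}\<close> the waste is at least a constant times \<open>min {\<surd>T, 1/l}\<close>, with probability at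
  least \<open>1/3 - 2 \<alpha> \<ge> 1/12\<close>. The coefficient \<open>waste_coeff\<close> carries a factor \<open>1 / \<surd>log T\<close> and is thus
  eventually smaller than any constant.
\<close>

subsection \<open>Concentration of sums of independent variables\<close>

text \<open>For \<open>\<bar>t\<bar> * \<rho> \<le> 1\<close> the Taylor remainder is at most a
  third of the quadratic term. With \<open>v\<close> the second moment of \<open>X\<close>, the
  modulus is therefore at most \<open>1 - t\<^sup>2 * v / 3\<close>, which lies below the
  exponential.\<close>

lemma (in prob_space) norm_char_distr_le_exp:
  fixes X :: "'a \<Rightarrow> real" and s \<rho> t :: real
  assumes rv [measurable]: "random_variable borel X"
    and bd: "AE \<omega> in M. \<bar>X \<omega>\<bar> \<le> \<rho>"
    and mean: "expectation X = 0"
    and var: "s \<le> expectation (\<lambda>\<omega>. (X \<omega>)\<^sup>2)"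
    and t: "\<bar>t\<bar> * \<rho> \<le> 1"
  shows "cmod (char (distr M borel X) t) \<le> exp (- (t\<^sup>2 * s / 4))"
proof -
  define v where "v = expectation (\<lambda>\<omega>. (X \<omega>)\<^sup>2)"
  have int: "integrable M X"
    using bd by (intro integrable_const_bound[where B = \<rho>]) auto
  have sq: "AE \<omega> in M. (X \<omega>)\<^sup>2 \<le> \<rho>\<^sup>2"
    using bd by eventually_elim (metis power2_abs abs_ge_zero power_mono)
  have int2: "integrable M (\<lambda>\<omega>. (X \<omega>)\<^sup>2)"
    using sq by (intro integrable_const_bound[where B = "\<rho>\<^sup>2"]) auto
  have "AE \<omega> in M. 0 \<le> \<rho>"
    using bd by eventually_elim (use abs_ge_zero order_trans in blast)
  then have rho: "0 \<le> \<rho>"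
    by simp
  have var_eq: "variance X = v"
    by (simp add: mean v_def)
  have v0: "0 \<le> v"
    unfolding v_def by simp
  have "v \<le> expectation (\<lambda>_. \<rho>\<^sup>2)"
    unfolding v_def using sq by (intro integral_mono_AE int2) auto
  then have "v \<le> \<rho>\<^sup>2"
    by (simp add: prob_space)
  \<comment> \<open>The bound \<open>t\<^sup>2 * v \<le> 1\<close> makes
    \<open>1 - t\<^sup>2 * v / 2\<close> nonnegative, hence equal to its modulus.\<close>
  have "t\<^sup>2 * v \<le> t\<^sup>2 * \<rho>\<^sup>2"
    using \<open>v \<le> \<rho>\<^sup>2\<close> by (simp add: mult_left_mono)
  also have "\<dots> = (\<bar>t\<bar> * \<rho>)\<^sup>2"
    by (simp add: power_mult_distrib)
  also have "\<dots> \<le> 1"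
    using t rho by (simp add: power_le_one)
  finally have tv: "t\<^sup>2 * v \<le> 1" .
  have "expectation (\<lambda>\<omega>. min (6 * (X \<omega>)\<^sup>2) (\<bar>t\<bar> * \<bar>X \<omega>\<bar> ^ 3)) \<le> v"
    unfolding v_def
  proof (rule integral_mono_AE)
    show "integrable M (\<lambda>\<omega>. min (6 * (X \<omega>)\<^sup>2) (\<bar>t\<bar> * \<bar>X \<omega>\<bar> ^ 3))"
      by (rule Bochner_Integration.integrable_bound[OF integrable_mult_right[OF int2, of 6]]) auto
    show "AE \<omega> in M. min (6 * (X \<omega>)\<^sup>2) (\<bar>t\<bar> * \<bar>X \<omega>\<bar> ^ 3) \<le> (X \<omega>)\<^sup>2"
      using bd
    proof eventually_elim
      case (elim \<omega>)
      have "\<bar>t\<bar> * \<bar>X \<omega>\<bar> ^ 3 = (\<bar>t\<bar> * \<bar>X \<omega>\<bar>) * (X \<omega>)\<^sup>2"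
        by (simp add: power3_eq_cube power2_eq_square)
      also have "\<bar>t\<bar> * \<bar>X \<omega>\<bar> \<le> \<bar>t\<bar> * \<rho>"
        using elim by (simp add: mult_left_mono)
      with t have "(\<bar>t\<bar> * \<bar>X \<omega>\<bar>) * (X \<omega>)\<^sup>2 \<le> 1 * (X \<omega>)\<^sup>2"
        by (intro mult_right_mono) auto
      finally show ?case
        by simp
    qed
  qed (rule int2)
  then have "t\<^sup>2 / 6 * expectation (\<lambda>\<omega>. min (6 * (X \<omega>)\<^sup>2) (\<bar>t\<bar> * \<bar>X \<omega>\<bar> ^ 3)) \<le> t\<^sup>2 / 6 * v"
    by (intro mult_left_mono) auto
  with char_approx3'[OF rv int int2 mean var_eq refl, of t]
  have "cmod (char (distr M borel X) t - (1 - t\<^sup>2 * v / 2)) \<le> t\<^sup>2 * v / 6"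
    by simp
  moreover have "cmod (char (distr M borel X) t)
      \<le> cmod (char (distr M borel X) t - (1 - t\<^sup>2 * v / 2)) + cmod (1 - t\<^sup>2 * v / 2)"
    by (metis add.commute norm_triangle_sub)
  moreover have "cmod (complex_of_real (1 - t\<^sup>2 * v / 2)) = 1 - t\<^sup>2 * v / 2"
    unfolding norm_of_real using tv by simp
  ultimately have "cmod (char (distr M borel X) t) \<le> 1 - t\<^sup>2 * v / 3"
    by simp
  also have "\<dots> \<le> 1 + - (t\<^sup>2 * s / 4)"
  proof -
    have "t\<^sup>2 * s \<le> t\<^sup>2 * v"
      using var by (simp add: v_def mult_left_mono)
    moreover have "0 \<le> t\<^sup>2 * v"
      using v0 by simp
    ultimately show ?thesis
      by linarith
  qed
  also have "\<dots> \<le> exp (- (t\<^sup>2 * s / 4))"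
    by (rule exp_ge_add_one_self)
  finally show ?thesis .
qed

text \<open>Multiplying the standard normal density by this factor gives \<open>\<tau>\<close> times
  the centred normal density of standard deviation \<open>\<tau> = 1 / sqrt (1 + 2 * a)\<close>,
  whose total mass is 1.\<close>

lemma has_bochner_integral_std_normal_exp_square:
  fixes a :: real
  assumes "a \<ge> 0"
  shows "has_bochner_integral std_normal_distribution (\<lambda>z. exp (- (a * z\<^sup>2))) (1 / sqrt (1 + 2 * a))"
proof -
  define \<tau> where "\<tau> = 1 / sqrt (1 + 2 * a)"
  have tau: "\<tau> > 0" "\<tau>\<^sup>2 = 1 / (1 + 2 * a)"
    using assms by (auto simp: \<tau>_def power_divide)
  have *: "std_normal_density z * exp (- (a * z\<^sup>2)) = \<tau> * normal_density 0 \<tau> z" for z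
  proof -
    have "- z\<^sup>2 / 2 + - (a * z\<^sup>2) = - z\<^sup>2 / (2 * \<tau>\<^sup>2)"
      unfolding tau by (simp add: field_simps)
    then have "exp (- z\<^sup>2 / 2) * exp (- (a * z\<^sup>2)) = exp (- z\<^sup>2 / (2 * \<tau>\<^sup>2))"
      by (simp add: exp_add[symmetric])
    then show ?thesis
      using tau(1) by (simp add: normal_density_def real_sqrt_mult)
  qed
  have "has_bochner_integral lborel (\<lambda>z. \<tau> * normal_density 0 \<tau> z) (\<tau> * 1)"
    using tau(1) by (intro has_bochner_integral_mult_right)
      (simp add: has_bochner_integral_iff)
  then show ?thesis
    unfolding \<tau>_def[symmetric]
    by (intro has_bochner_integral_density) (auto simp: *)
qed

lemma has_bochner_integral_std_normal_square:
  "has_bochner_integral std_normal_distribution (\<lambda>z. z\<^sup>2) 1"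
  using std_normal_moment_even[of 1]
  by (intro has_bochner_integral_density) auto

text \<open>
  Esseen's smoothing argument with a Gaussian kernel: the indicator of \<open>[-\<eta>, \<eta>]\<close> is at most
  \<open>\<surd>e\<close> times \<open>y \<mapsto> exp (- y\<^sup>2 / (2 \<eta>\<^sup>2))\<close>, which is the characteristic function of a normal law, so that
  the probability is controlled by the characteristic function of the sum at \<open>Z / \<eta>\<close>, \<open>Z\<close> standard
  normal.
\<close>

lemma (in prob_space) prob_sum_near_le:
  fixes X :: "'i \<Rightarrow> 'a \<Rightarrow> real" and s \<rho> \<eta> x :: real
  assumes indep: "indep_vars (\<lambda>_. borel) X I"
    and bd: "\<And>i. i \<in> I \<Longrightarrow> AE \<omega> in M. \<bar>X i \<omega>\<bar> \<le> \<rho>"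
    and mean: "\<And>i. i \<in> I \<Longrightarrow> expectation (X i) = 0"
    and var: "\<And>i. i \<in> I \<Longrightarrow> s \<le> expectation (\<lambda>\<omega>. (X i \<omega>)\<^sup>2)"
    and s: "0 \<le> s" and rho: "0 < \<rho>" and eta: "0 < \<eta>"
  shows "prob {\<omega> \<in> space M. \<bar>(\<Sum>i\<in>I. X i \<omega>) - x\<bar> \<le> \<eta>}
    \<le> 2 * (1 / sqrt (1 + card I * s / (2 * \<eta>\<^sup>2)) + (\<rho> / \<eta>)\<^sup>2)"
proof -
  let ?N = std_normal_distribution
  have rv: "random_variable borel (X i)" if "i \<in> I" for i
    using indep that by (auto simp: indep_vars_def)
  define Y where "Y \<omega> = ((\<Sum>i\<in>I. X i \<omega>) - x) / \<eta>" for \<omega>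
  have sum_rv [measurable]: "random_variable borel (\<lambda>\<omega>. \<Sum>i\<in>I. X i \<omega>)"
    using rv by (intro borel_measurable_sum) auto
  have Y [measurable]: "random_variable borel Y"
    unfolding Y_def by measurable
  interpret N: prob_space ?N
    by (rule prob_space_normal_density) simp
  interpret MN: pair_prob_space M ?N ..
  interpret D: real_distribution "distr M borel (\<lambda>\<omega>. \<Sum>i\<in>I. X i \<omega>)"
    by simp
  let ?E = "{\<omega> \<in> space M. \<bar>(\<Sum>i\<in>I. X i \<omega>) - x\<bar> \<le> \<eta>}"
  \<comment> \<open>Chosen so that the product over \<open>I\<close> of the bounds
    \<open>exp (- ((z / \<eta>)\<^sup>2 * s / 4))\<close> is
    \<open>exp (- (a * z\<^sup>2))\<close>.\<close>
  define a where "a = card I * s / (4 * \<eta>\<^sup>2)"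
  have a0: "a \<ge> 0"
    using s by (simp add: a_def)

  \<comment> \<open>The factor sqrt e of the smoothing is rounded up to 2, the leading factor of the
    bound.\<close>
  have half: "exp (1 / 2) \<le> (2 :: real)"
  proof (rule power2_le_imp_le)
    show "(exp (1 / 2 :: real))\<^sup>2 \<le> 2\<^sup>2"
      using exp_le by (simp add: exp_double[symmetric])
  qed simp
  have intG: "integrable M (\<lambda>\<omega>. exp (- (Y \<omega>)\<^sup>2 / 2))"
    by (rule integrable_const_bound[where B = 1]) auto
  have "prob ?E = expectation (indicator ?E)"
    by (simp add: Int_absorb1)
  also have "\<dots> \<le> expectation (\<lambda>\<omega>. 2 * exp (- (Y \<omega>)\<^sup>2 / 2))"
  proof (rule integral_mono)
    fix \<omega> assume "\<omega> \<in> space M"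
    show "indicator ?E \<omega> \<le> 2 * exp (- (Y \<omega>)\<^sup>2 / 2)"
    proof (cases "\<omega> \<in> ?E")
      case True
      then have "\<bar>Y \<omega>\<bar> \<le> 1"
        using eta by (simp add: Y_def)
      then have "(Y \<omega>)\<^sup>2 \<le> 1"
        by (simp add: abs_square_le_1)
      then have "exp (- (1 / 2)) \<le> exp (- (Y \<omega>)\<^sup>2 / 2)"
        by simp
      moreover have "1 \<le> 2 * exp (- (1 / 2) :: real)"
        using half by (simp add: exp_minus field_simps)
      ultimately have "1 \<le> 2 * exp (- (Y \<omega>)\<^sup>2 / 2)"
        by linarith
      then show ?thesis
        using True by simp
    qed simp
  next
    show "integrable M (indicat_real ?E)"
      by (rule integrable_const_bound[where B = 1]) (auto simp: indicator_def)
  qed (use intG in auto)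
  also have "\<dots> = 2 * expectation (\<lambda>\<omega>. exp (- (Y \<omega>)\<^sup>2 / 2))"
    by simp
  also have "expectation (\<lambda>\<omega>. exp (- (Y \<omega>)\<^sup>2 / 2)) \<le> 1 / sqrt (1 + 2 * a) + (\<rho> / \<eta>)\<^sup>2"
  proof -
    have intF: "integrable (M \<Otimes>\<^sub>M ?N) (\<lambda>(\<omega>, z). iexp (Y \<omega> * z))"
      by (rule MN.integrable_const_bound[where B = 1]) (auto simp: split_beta)
    have "complex_of_real (expectation (\<lambda>\<omega>. exp (- (Y \<omega>)\<^sup>2 / 2)))
        = (CLINT \<omega>|M. char ?N (Y \<omega>))"
      by (simp add: char_std_normal_distribution flip: integral_complex_of_real)
    also have "\<dots> = (CLINT \<omega>|M. CLINT z|?N. iexp (Y \<omega> * z))"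
      by (simp add: char_def)
    also have "\<dots> = (CLINT z|?N. CLINT \<omega>|M. iexp (Y \<omega> * z))"
      using MN.Fubini_integral[OF intF] by simp
    finally have eq: "complex_of_real (expectation (\<lambda>\<omega>. exp (- (Y \<omega>)\<^sup>2 / 2)))
      = (CLINT z|?N. CLINT \<omega>|M. iexp (Y \<omega> * z))" .
    \<comment> \<open>For \<open>\<bar>z / \<eta>\<bar> * \<rho> \<le> 1\<close> the characteristic
      function factorizes and each factor decays. For larger \<open>z\<close> the trivial bound 1 is
      below \<open>(\<rho> / \<eta>)\<^sup>2 * z\<^sup>2\<close>, whose Gaussian mean is the error
      term.\<close>
    have inner: "cmod (CLINT \<omega>|M. iexp (Y \<omega> * z)) \<le> exp (- (a * z\<^sup>2)) + (\<rho> / \<eta>)\<^sup>2 * z\<^sup>2" for z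
    proof -
      have "(CLINT \<omega>|M. iexp (Y \<omega> * z))
          = (CLINT \<omega>|M. iexp (- (x * z / \<eta>)) * iexp (z / \<eta> * (\<Sum>i\<in>I. X i \<omega>)))"
        by (simp add: Y_def exp_add[symmetric] algebra_simps diff_divide_distrib)
      also have "\<dots> = iexp (- (x * z / \<eta>)) * char (distr M borel (\<lambda>\<omega>. \<Sum>i\<in>I. X i \<omega>)) (z / \<eta>)"
        by (simp add: char_def integral_distr)
      finally have nrm: "cmod (CLINT \<omega>|M. iexp (Y \<omega> * z))
          = cmod (char (distr M borel (\<lambda>\<omega>. \<Sum>i\<in>I. X i \<omega>)) (z / \<eta>))"
        by (simp add: norm_mult)
      show ?thesis
      proof (cases "\<bar>z / \<eta>\<bar> * \<rho> \<le> 1")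
        case True
        have "cmod (char (distr M borel (\<lambda>\<omega>. \<Sum>i\<in>I. X i \<omega>)) (z / \<eta>))
            = (\<Prod>i\<in>I. cmod (char (distr M borel (X i)) (z / \<eta>)))"
          by (simp add: char_distr_sum[OF indep] prod_norm)
        also have "\<dots> \<le> (\<Prod>i\<in>I. exp (- ((z / \<eta>)\<^sup>2 * s / 4)))"
        proof (intro prod_mono conjI)
          fix i assume "i \<in> I"
          then show "cmod (char (distr M borel (X i)) (z / \<eta>)) \<le> exp (- ((z / \<eta>)\<^sup>2 * s / 4))"
            using True by (intro norm_char_distr_le_exp[OF rv bd mean var])
        qed simp
        also have "\<dots> = exp (- (a * z\<^sup>2))"
          by (simp add: exp_of_nat_mult[symmetric] a_def power_divide field_simps)
        finally show ?thesis
          using nrm by (simp add: add_increasing2)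
      next
        case False
        then have "1 \<le> (\<bar>z / \<eta>\<bar> * \<rho>)\<^sup>2"
          by simp
        also have "\<dots> = (\<rho> / \<eta>)\<^sup>2 * z\<^sup>2"
          by (simp add: power_mult_distrib power_divide)
        finally have "1 \<le> (\<rho> / \<eta>)\<^sup>2 * z\<^sup>2" .
        then show ?thesis
          using nrm D.cmod_char_le_1[of "z / \<eta>"] by (smt (verit) exp_gt_zero)
      qed
    qed
    have bnd: "has_bochner_integral ?N (\<lambda>z. exp (- (a * z\<^sup>2)) + (\<rho> / \<eta>)\<^sup>2 * z\<^sup>2)
        (1 / sqrt (1 + 2 * a) + (\<rho> / \<eta>)\<^sup>2 * 1)"
      by (intro has_bochner_integral_add has_bochner_integral_mult_right
          has_bochner_integral_std_normal_exp_square has_bochner_integral_std_normal_square a0)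
    have "expectation (\<lambda>\<omega>. exp (- (Y \<omega>)\<^sup>2 / 2)) = cmod (CLINT z|?N. CLINT \<omega>|M. iexp (Y \<omega> * z))"
      unfolding eq[symmetric] by simp
    also have "\<dots> \<le> (LINT z|?N. cmod (CLINT \<omega>|M. iexp (Y \<omega> * z)))"
      by (rule integral_norm_bound)
    also have "\<dots> \<le> (LINT z|?N. exp (- (a * z\<^sup>2)) + (\<rho> / \<eta>)\<^sup>2 * z\<^sup>2)"
      using bnd inner by (intro integral_mono') (auto simp: has_bochner_integral_iff)
    also have "\<dots> = 1 / sqrt (1 + 2 * a) + (\<rho> / \<eta>)\<^sup>2"
      using bnd by (simp add: has_bochner_integral_iff)
    finally show ?thesis .
  qed
  finally show ?thesis
    by (simp add: a_def mult.commute)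
qed

text \<open>For the least median \<open>m\<close>, both \<open>f \<ge> m\<close> and
  \<open>f \<le> m\<close> have probability at least 1/2, and removing the window of radius
  \<open>\<eta>\<close> around \<open>m\<close> costs at most \<open>1 / 2 - p\<close>.\<close>

lemma (in prob_space) spread_around_median:
  fixes f :: "'a \<Rightarrow> nat"
  assumes f [measurable]: "f \<in> measurable M (count_space UNIV)"
    and near: "\<And>x. prob {\<omega> \<in> space M. \<bar>real (f \<omega>) - x\<bar> \<le> \<eta>} \<le> 1 / 2 - p"
  obtains m :: real where
    "p \<le> prob {\<omega> \<in> space M. real (f \<omega>) > m + \<eta>}"
    "p \<le> prob {\<omega> \<in> space M. real (f \<omega>) < m - \<eta>}"
proof -
  have "(\<lambda>n. prob {\<omega> \<in> space M. f \<omega> \<le> n}) \<longlonglongrightarrow> prob (\<Union>n. {\<omega> \<in> space M. f \<omega> \<le> n})"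
    by (rule finite_Lim_measure_incseq) (auto simp: incseq_def)
  also have "(\<Union>n. {\<omega> \<in> space M. f \<omega> \<le> n}) = space M"
    by auto
  finally have "\<forall>\<^sub>F n in sequentially. 1 / 2 < prob {\<omega> \<in> space M. f \<omega> \<le> n}"
    by (intro order_tendstoD(1)[where y = 1]) (simp_all add: prob_space)
  then have ex: "\<exists>n. 1 / 2 \<le> prob {\<omega> \<in> space M. f \<omega> \<le> n}"
    by (auto simp: eventually_sequentially intro: less_imp_le)
  define m where "m = (LEAST n. 1 / 2 \<le> prob {\<omega> \<in> space M. f \<omega> \<le> n})"
  let ?near = "{\<omega> \<in> space M. \<bar>real (f \<omega>) - real m\<bar> \<le> \<eta>}"
  have low: "1 / 2 \<le> prob {\<omega> \<in> space M. f \<omega> \<le> m}"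
    unfolding m_def by (rule LeastI_ex[OF ex])
  have "prob {\<omega> \<in> space M. f \<omega> < m} \<le> 1 / 2"
  proof (cases m)
    case (Suc j)
    then have "\<not> 1 / 2 \<le> prob {\<omega> \<in> space M. f \<omega> \<le> j}"
      using not_less_Least[of j "\<lambda>n. 1 / 2 \<le> prob {\<omega> \<in> space M. f \<omega> \<le> n}"]
      by (simp add: m_def)
    then show ?thesis
      using Suc by (simp add: less_Suc_eq_le)
  qed simp
  moreover have "prob {\<omega> \<in> space M. \<not> f \<omega> < m} = 1 - prob {\<omega> \<in> space M. f \<omega> < m}"
    by (rule prob_neg) measurable
  ultimately have high: "1 / 2 \<le> prob {\<omega> \<in> space M. m \<le> f \<omega>}"
    by (simp add: not_less)
  show thesis
  proof
    have "prob {\<omega> \<in> space M. m \<le> f \<omega>} \<le> prob ({\<omega> \<in> space M. real (f \<omega>) > real m + \<eta>} \<union> ?near)"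
      by (rule finite_measure_mono) auto
    also have "\<dots> \<le> prob {\<omega> \<in> space M. real (f \<omega>) > real m + \<eta>} + prob ?near"
      by (rule measure_Un_le) auto
    finally show "p \<le> prob {\<omega> \<in> space M. real (f \<omega>) > real m + \<eta>}"
      using high near[of m] by linarith
    have "prob {\<omega> \<in> space M. f \<omega> \<le> m} \<le> prob ({\<omega> \<in> space M. real (f \<omega>) < real m - \<eta>} \<union> ?near)"
      by (rule finite_measure_mono) auto
    also have "\<dots> \<le> prob {\<omega> \<in> space M. real (f \<omega>) < real m - \<eta>} + prob ?near"
      by (rule measure_Un_le) auto
    finally show "p \<le> prob {\<omega> \<in> space M. real (f \<omega>) < real m - \<eta>}"
      using low near[of m] by linarith
  qed
qed

text \<open>This is \<open>prob_sum_near_le\<close> for the centred coordinates, with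
  \<open>x\<close> shifted by the sum of the means.\<close>

lemma Pi_pmf_sum_near_le:
  fixes p :: "'i \<Rightarrow> nat pmf" and \<sigma> \<rho> \<eta> x :: real
  assumes fin: "finite I"
    and bd: "\<And>i. i \<in> I \<Longrightarrow> AE n in measure_pmf (p i). \<bar>real n - measure_pmf.expectation (p i) real\<bar> \<le> \<rho>"
    and var: "\<And>i. i \<in> I \<Longrightarrow> \<sigma>\<^sup>2 \<le> measure_pmf.variance (p i) real"
    and pos: "0 < \<rho>" "0 < \<eta>"
  shows "measure_pmf.prob (Pi_pmf I 0 p) {g. \<bar>real (\<Sum>i\<in>I. g i) - x\<bar> \<le> \<eta>}
    \<le> 2 * (1 / sqrt (1 + real (card I) * \<sigma>\<^sup>2 / (2 * \<eta>\<^sup>2)) + (\<rho> / \<eta>)\<^sup>2)"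
proof -
  define e where "e i = measure_pmf.expectation (p i) real" for i
  let ?M = "Pi_pmf I 0 p"
  have comp: "measure_pmf.expectation ?M (\<lambda>g. h (g i)) = measure_pmf.expectation (p i) h"
    if "i \<in> I" for i and h :: "nat \<Rightarrow> real"
    using fin that by (metis (no_types) Pi_pmf_component integral_map_pmf)
  have AE: "AE g in measure_pmf ?M. \<bar>real (g i) - e i\<bar> \<le> \<rho>" if "i \<in> I" for i
  proof -
    have "AE n in measure_pmf (map_pmf (\<lambda>g. g i) ?M). \<bar>real n - e i\<bar> \<le> \<rho>"
      using bd[OF that] fin that by (simp only: Pi_pmf_component if_True e_def)
    then show ?thesis
      by (simp add: AE_measure_pmf_iff)
  qed
  have "prob_space.indep_vars (measure_pmf ?M) (\<lambda>_. borel) (\<lambda>i g. real (g i) - e i) I"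
    by (rule prob_space.indep_vars_compose2[OF measure_pmf.prob_space_axioms indep_vars_Pi_pmf[OF fin]])
      auto
  moreover have "measure_pmf.expectation ?M (\<lambda>g. real (g i) - e i) = 0" if "i \<in> I" for i
  proof -
    \<comment> \<open>The bounded deviation is integrable; adding the constant back makes
      \<open>real\<close> integrable, and then linearity gives mean 0.\<close>
    have "integrable (measure_pmf (p i)) (\<lambda>n. real n - e i)"
      using bd[OF that] by (intro measure_pmf.integrable_const_bound[where B = \<rho>]) (auto simp: e_def)
    then have "integrable (measure_pmf (p i)) (\<lambda>n. (real n - e i) + e i)"
      by (intro Bochner_Integration.integrable_add) auto
    then have "integrable (measure_pmf (p i)) real"
      by simp
    then show ?thesis
      using comp[OF that, of "\<lambda>n. real n - e i"] by (simp add: e_def)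
  qed
  moreover have "\<sigma>\<^sup>2 \<le> measure_pmf.expectation ?M (\<lambda>g. (real (g i) - e i)\<^sup>2)" if "i \<in> I" for i
    using comp[OF that, of "\<lambda>n. (real n - e i)\<^sup>2"] var[OF that] by (simp add: e_def)
  ultimately have "measure_pmf.prob ?M {g \<in> space ?M. \<bar>(\<Sum>i\<in>I. real (g i) - e i) - (x - (\<Sum>i\<in>I. e i))\<bar> \<le> \<eta>}
    \<le> 2 * (1 / sqrt (1 + real (card I) * \<sigma>\<^sup>2 / (2 * \<eta>\<^sup>2)) + (\<rho> / \<eta>)\<^sup>2)"
    using AE pos by (intro prob_space.prob_sum_near_le measure_pmf.prob_space_axioms) auto
  then show ?thesis
    by (simp add: sum_subtractf)
qed

subsection \<open>Two continuations of one history\<close>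

lemma prob_pair_pmf_Times:
  "measure_pmf.prob (pair_pmf M N) (A \<times> B) = measure_pmf.prob M A * measure_pmf.prob N B"
proof -
  \<comment> \<open>Intersecting with the supports makes both sets countable, as the product rule
    for pmfs demands.\<close>
  have "measure_pmf.prob (pair_pmf M N) (A \<times> B)
      = measure_pmf.prob (pair_pmf M N) ((A \<inter> set_pmf M) \<times> (B \<inter> set_pmf N))"
    by (rule measure_prob_cong_0) (auto simp: pmf_pair pmf_eq_0_set_pmf)
  also have "\<dots> = measure_pmf.prob M (A \<inter> set_pmf M) * measure_pmf.prob N (B \<inter> set_pmf N)"
    by (rule measure_pmf_prob_product) auto
  finally show ?thesis
    by (simp add: measure_Int_set_pmf)
qed

text \<open>
  If no continuation in \<open>A\<close> of the history \<open>f\<close> lies in \<open>G\<close>, then \<open>f\<close> alone costs a conditional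
  probability of at least \<open>p\<close>; so the mass of such histories is at most \<open>P(-G) / p\<close>.
\<close>

lemma prob_pair_pmf_two_continuations:
  fixes M :: "'a pmf" and N :: "'b pmf" and G :: "('a \<times> 'b) set"
  assumes p: "0 < p"
    and A: "p \<le> measure_pmf.prob N A" and B: "p \<le> measure_pmf.prob N B"
  shows "p - 2 * measure_pmf.prob (pair_pmf M N) (- G)
    \<le> measure_pmf.prob (pair_pmf M N)
        {(f, g). g \<in> B \<and> (f, g) \<in> G \<and> (\<exists>g'\<in>A \<inter> set_pmf N. (f, g') \<in> G)}"
proof -
  let ?D = "pair_pmf M N" and ?d = "measure_pmf.prob (pair_pmf M N) (- G)"
  define Bad where "Bad = {f. \<forall>g'\<in>A \<inter> set_pmf N. (f, g') \<notin> G}"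
  let ?W = "{(f, g). g \<in> B \<and> (f, g) \<in> G \<and> (\<exists>g'\<in>A \<inter> set_pmf N. (f, g') \<in> G)}"
  have "p * measure_pmf.prob M Bad \<le> measure_pmf.prob N (A \<inter> set_pmf N) * measure_pmf.prob M Bad"
    using A by (intro mult_right_mono) (auto simp: measure_Int_set_pmf)
  also have "\<dots> = measure_pmf.prob ?D (Bad \<times> (A \<inter> set_pmf N))"
    by (simp add: prob_pair_pmf_Times mult.commute)
  also have "\<dots> \<le> ?d"
    by (rule measure_pmf.finite_measure_mono) (auto simp: Bad_def)
  finally have bad: "p * measure_pmf.prob M Bad \<le> ?d" .
  \<comment> \<open>A history outside \<open>Bad\<close> followed by a continuation in
    \<open>B\<close> lies in \<open>?W\<close> or fails \<open>G\<close>. The failure probability is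
    thus paid a second time, whence the factor 2.\<close>
  have "p * measure_pmf.prob M (- Bad) \<le> measure_pmf.prob M (- Bad) * measure_pmf.prob N B"
    using B by (subst mult.commute) (intro mult_left_mono; simp)
  also have "\<dots> = measure_pmf.prob ?D ((- Bad) \<times> B)"
    by (simp add: prob_pair_pmf_Times)
  also have "\<dots> \<le> measure_pmf.prob ?D (?W \<union> - G)"
    by (rule measure_pmf.finite_measure_mono) (auto simp: Bad_def)
  also have "\<dots> \<le> measure_pmf.prob ?D ?W + ?d"
    by (rule measure_Un_le) auto
  finally have "p * measure_pmf.prob M (- Bad) \<le> measure_pmf.prob ?D ?W + ?d" .
  moreover have "measure_pmf.prob M (- Bad) = 1 - measure_pmf.prob M Bad"
    using measure_pmf.prob_compl[of Bad M] by (simp add: Compl_eq_Diff_UNIV)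
  ultimately show ?thesis
    using bad by (simp add: algebra_simps)
qed

text \<open>Here \<open>c\<close> is the common spending before the split. Feasibility gives
  \<open>c \<le> B - sA\<close>, so the waste is at least \<open>sA - sB\<close>; the envy bounds
  cost \<open>L * (a + b)\<close> in this difference.\<close>

lemma waste_of_two_continuations:
  fixes B N0 a b L c sA sB :: real
  assumes "c + sA \<le> B" "a * (B / (N0 + a) - L) \<le> sA" "sB \<le> b * (B / (N0 + b) + L)"
    and "0 < N0" "0 \<le> a" "0 \<le> b"
  shows "B * N0 * (a - b) / ((N0 + a) * (N0 + b)) - L * (a + b) \<le> B - (c + sB)"
proof -
  have "B * N0 * (a - b) / ((N0 + a) * (N0 + b)) = a * (B / (N0 + a)) - b * (B / (N0 + b))"
    using assms(4-6) by (simp add: field_simps)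
  then show ?thesis
    using assms(1-3) by (simp add: algebra_simps)
qed

section \<open>The waste under one fixed seed\<close>

lemma allocation_cong:
  assumes "\<And>i. 1 \<le> i \<Longrightarrow> i \<le> t \<Longrightarrow> n i = n' i"
  shows "allocation X t (s, n) = allocation X t (s, n')"
proof -
  have "map n [1..<Suc t] = map n' [1..<Suc t]"
    using assms by (intro map_cong) auto
  then show ?thesis
    by (simp only: allocation_def fst_conv snd_conv)
qed

lemma envy_leD:
  assumes "envy P X \<omega> \<le> l" "t \<in> {1..rounds P}"
  shows "\<bar>allocation X t \<omega> - hindsight_allocation P \<omega>\<bar> \<le> l"
proof -
  have "\<bar>allocation X t \<omega> - hindsight_allocation P \<omega>\<bar> \<le> envy P X \<omega>"
    unfolding envy_def using assms(2) by (intro Max_ge) auto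
  with assms(1) show ?thesis
    by simp
qed

text \<open>History and last \<open>k\<close> rounds are independent, so with the probability from
  \<open>prob_pair_pmf_two_continuations\<close> a low continuation has a high companion for the
  same history, both with envy at most \<open>l\<close>. The low one then wastes the stated
  amount.\<close>

lemma prob_waste_ge_fixed_seed:
  fixes \<beta> \<eta> H l m :: real
  assumes k: "2 * k \<le> rounds P" and T: "1 \<le> rounds P"
    and range: "\<And>t n. t \<in> {1..rounds P} \<Longrightarrow> n \<in> set_pmf (arrivals P t) \<Longrightarrow> 1 \<le> n \<and> real n \<le> H"
    and budget: "\<beta> * real (rounds P) \<le> budget P"
    and nonneg: "0 \<le> \<beta>" "0 \<le> l" "0 \<le> \<eta>"
    and feasible: "AE n in measure_pmf (arrivals_law P). spent P X (s, n) \<le> budget P"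
    and J: "J = {rounds P - k + 1..rounds P}"
    and high: "1 / 3 \<le> measure_pmf.prob (Pi_pmf J 0 (arrivals P)) {g. real (\<Sum>t\<in>J. g t) > m + \<eta>}"
    and low: "1 / 3 \<le> measure_pmf.prob (Pi_pmf J 0 (arrivals P)) {g. real (\<Sum>t\<in>J. g t) < m - \<eta>}"
  shows "1 / 3 - 2 * measure_pmf.prob (arrivals_law P) {n. \<not> envy P X (s, n) \<le> l}
    \<le> measure_pmf.prob (arrivals_law P) {n. \<beta> * \<eta> / H\<^sup>2 - 2 * l * k * H \<le> waste P X (s, n)}"
proof -
  let ?T = "rounds P"
  define I where "I = {1..?T - k}"
  have IJ: "{1..?T} = I \<union> J" "I \<inter> J = {}" "finite I" "finite J" "card I = ?T - k" "card J = k"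
    using k by (auto simp: I_def J)
  define M where "M = Pi_pmf I 0 (arrivals P)"
  define N where "N = Pi_pmf J 0 (arrivals P)"
  define h where "h = (\<lambda>(f, g) x. if x \<in> I then f x else g x :: nat)"
  have law: "arrivals_law P = map_pmf h (pair_pmf M N)"
    unfolding arrivals_law_def IJ(1) M_def N_def h_def using IJ by (intro Pi_pmf_union) auto
  \<comment> \<open>Restricting to the support turns almost sure feasibility and the range of the
    arrivals into pointwise facts on \<open>G\<close>.\<close>
  define G where "G = {\<omega> \<in> set_pmf (pair_pmf M N). envy P X (s, h \<omega>) \<le> l}"
  let ?A = "{g. real (\<Sum>t\<in>J. g t) > m + \<eta>}" and ?B = "{g. real (\<Sum>t\<in>J. g t) < m - \<eta>}"
  let ?W = "{(f, g). g \<in> ?B \<and> (f, g) \<in> G \<and> (\<exists>g'\<in>?A \<inter> set_pmf N. (f, g') \<in> G)}"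
  have feas: "spent P X (s, h \<omega>) \<le> budget P" if "\<omega> \<in> G" for \<omega>
    using feasible that by (auto simp: AE_measure_pmf_iff law G_def)
  have sumM: "real (?T - k) \<le> (\<Sum>t\<in>I. real (f t))" "(\<Sum>t\<in>I. real (f t)) \<le> real (?T - k) * H"
    if "f \<in> set_pmf M" for f
  proof -
    have "f t \<in> set_pmf (arrivals P t)" if "t \<in> I" for t
      using \<open>f \<in> set_pmf M\<close> that IJ by (auto simp: M_def set_Pi_pmf PiE_dflt_def)
    then have "1 \<le> real (f t) \<and> real (f t) \<le> H" if "t \<in> I" for t
      using range[of t "f t"] that unfolding IJ(1) by auto
    then show "real (?T - k) \<le> (\<Sum>t\<in>I. real (f t))" "(\<Sum>t\<in>I. real (f t)) \<le> real (?T - k) * H"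
      using sum_bounded_below[of I 1 "\<lambda>t. real (f t)"] sum_bounded_above[of I "\<lambda>t. real (f t)" H] IJ(5)
      by auto
  qed
  have sumN: "(\<Sum>t\<in>J. real (g t)) \<le> real k * H" if "g \<in> set_pmf N" for g
  proof -
    have "g t \<in> set_pmf (arrivals P t)" if "t \<in> J" for t
      using \<open>g \<in> set_pmf N\<close> that IJ by (auto simp: N_def set_Pi_pmf PiE_dflt_def)
    then have "real (g t) \<le> H" if "t \<in> J" for t
      using range[of t "g t"] that unfolding IJ(1) by auto
    then show ?thesis
      using sum_bounded_above[of J "\<lambda>t. real (g t)" H] IJ(6) by auto
  qed
  have total: "total_arrivals P (h (f, g)) = (\<Sum>t\<in>I. real (f t)) + (\<Sum>t\<in>J. real (g t))" for f g
  proof -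
    have "total_arrivals P (h (f, g)) = (\<Sum>t\<in>I. real (h (f, g) t)) + (\<Sum>t\<in>J. real (h (f, g) t))"
      unfolding total_arrivals_def IJ(1) using IJ by (intro sum.union_disjoint) auto
    moreover have "(\<Sum>t\<in>J. real (h (f, g) t)) = (\<Sum>t\<in>J. real (g t))"
      using IJ(2) by (intro sum.cong) (auto simp: h_def)
    ultimately show ?thesis
      by (simp add: h_def)
  qed
  have spent: "spent P X (s, h (f, g)) = (\<Sum>t\<in>I. real (f t) * allocation X t (s, h (f, g)))
      + (\<Sum>t\<in>J. real (g t) * allocation X t (s, h (f, g)))" for f g
  proof -
    have "spent P X (s, h (f, g)) = (\<Sum>t\<in>I. real (h (f, g) t) * allocation X t (s, h (f, g)))
        + (\<Sum>t\<in>J. real (h (f, g) t) * allocation X t (s, h (f, g)))"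
      unfolding spent_def IJ(1) snd_conv using IJ by (intro sum.union_disjoint) auto
    moreover have "(\<Sum>t\<in>J. real (h (f, g) t) * allocation X t (s, h (f, g)))
        = (\<Sum>t\<in>J. real (g t) * allocation X t (s, h (f, g)))"
      using IJ(2) by (intro sum.cong) (auto simp: h_def)
    ultimately show ?thesis
      by (simp add: h_def)
  qed
  have waste: "\<beta> * \<eta> / H\<^sup>2 - 2 * l * k * H \<le> waste P X (s, h (f, g))"
    if g: "g \<in> ?B" "(f, g) \<in> G" and g': "g' \<in> ?A" "(f, g') \<in> G" for f g g'
  proof -
    define N0 a b where "N0 = (\<Sum>t\<in>I. real (f t))" and "a = (\<Sum>t\<in>J. real (g' t))"
      and "b = (\<Sum>t\<in>J. real (g t))"
    note defs = this
    have supp: "f \<in> set_pmf M" "g \<in> set_pmf N" "g' \<in> set_pmf N"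
      using g g' by (auto simp: G_def)
    have ab: "2 * \<eta> \<le> a - b" "0 \<le> a" "0 \<le> b" "a \<le> real k * H" "b \<le> real k * H"
      using g(1) g'(1) sumN supp by (auto simp: defs intro: sum_nonneg)
    have N0: "real ?T / 2 \<le> N0" "N0 \<le> real (?T - k) * H" "0 < N0"
    proof -
      have "real ?T / 2 \<le> real (?T - k)"
        using k by (simp add: of_nat_diff)
      then show "real ?T / 2 \<le> N0" "N0 \<le> real (?T - k) * H"
        using sumM[OF supp(1)] by (auto simp: defs)
      then show "0 < N0"
        using T by auto
    qed
    have tot: "x + N0 \<le> real ?T * H" if "x \<le> real k * H" for x
    proof -
      have "x + N0 \<le> (real k + real (?T - k)) * H"
        using that N0(2) by (simp add: distrib_right)
      also have "real k + real (?T - k) = real ?T"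
        using k by simp
      finally show ?thesis .
    qed
    have HT: "0 < real ?T * H"
      using tot[OF ab(4)] ab(2) N0(3) by linarith
    then have H: "0 < H"
      using T by (simp add: zero_less_mult_iff)
    define c where "c = (\<Sum>t\<in>I. real (f t) * allocation X t (s, h (f, g')))"
    define sA where "sA = (\<Sum>t\<in>J. real (g' t) * allocation X t (s, h (f, g')))"
    define sB where "sB = (\<Sum>t\<in>J. real (g t) * allocation X t (s, h (f, g)))"
    \<comment> \<open>The online property enters here: rounds in \<open>I\<close> precede those in
      \<open>J\<close>, so their allocations cannot depend on the continuation.\<close>
    have "c = (\<Sum>t\<in>I. real (f t) * allocation X t (s, h (f, g)))"
      unfolding c_def by (intro sum.cong refl arg_cong[where f = "(*) _"] allocation_cong)
        (auto simp: h_def I_def)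
    then have w: "waste P X (s, h (f, g)) = budget P - (c + sB)"
      by (simp add: waste_def spent sB_def)
    have "c + sA \<le> budget P"
      using feas[OF g'(2)] by (simp add: spent c_def sA_def)
    moreover have "a * (budget P / (N0 + a) - l) \<le> sA"
    proof -
      have "real (g' t) * (budget P / (N0 + a) - l) \<le> real (g' t) * allocation X t (s, h (f, g'))"
        if "t \<in> J" for t
      proof (rule mult_left_mono)
        have "envy P X (s, h (f, g')) \<le> l"
          using g'(2) by (simp add: G_def)
        then have "\<bar>allocation X t (s, h (f, g')) - budget P / (N0 + a)\<bar> \<le> l"
          using envy_leD[of P X "(s, h (f, g'))" l t] that unfolding IJ(1)
          by (simp add: hindsight_allocation_def total defs)
        then show "budget P / (N0 + a) - l \<le> allocation X t (s, h (f, g'))"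
          by linarith
      qed simp
      then show ?thesis
        unfolding a_def sA_def sum_distrib_right by (intro sum_mono) auto
    qed
    moreover have "sB \<le> b * (budget P / (N0 + b) + l)"
    proof -
      have "real (g t) * allocation X t (s, h (f, g)) \<le> real (g t) * (budget P / (N0 + b) + l)"
        if "t \<in> J" for t
      proof (rule mult_left_mono)
        have "envy P X (s, h (f, g)) \<le> l"
          using g(2) by (simp add: G_def)
        then have "\<bar>allocation X t (s, h (f, g)) - budget P / (N0 + b)\<bar> \<le> l"
          using envy_leD[of P X "(s, h (f, g))" l t] that unfolding IJ(1)
          by (simp add: hindsight_allocation_def total defs)
        then show "allocation X t (s, h (f, g)) \<le> budget P / (N0 + b) + l"
          by linarith
      qed simp
      then show ?thesis
        unfolding b_def sB_def sum_distrib_right by (intro sum_mono) auto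
    qed
    ultimately have "budget P * N0 * (a - b) / ((N0 + a) * (N0 + b)) - l * (a + b) \<le> waste P X (s, h (f, g))"
      unfolding w using N0(3) ab by (intro waste_of_two_continuations)
    moreover have "l * (a + b) \<le> 2 * l * k * H"
      using mult_left_mono[of "a + b" "2 * (k * H)" l] ab nonneg by simp
    moreover have "\<beta> * \<eta> / H\<^sup>2 \<le> budget P * N0 * (a - b) / ((N0 + a) * (N0 + b))"
    proof -
      \<comment> \<open>The right side collects the crude bounds: budget at least \<beta> T, history
        at least T/2, gap \<open>a - b\<close> at least 2 \<eta>, and each total at most T
        H.\<close>
      have "\<beta> * \<eta> / H\<^sup>2 = (\<beta> * real ?T * (real ?T / 2) * (2 * \<eta>)) / ((real ?T * H) * (real ?T * H))"
        using T H by (simp add: field_simps power2_eq_square)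
      also have "\<dots> \<le> budget P * N0 * (a - b) / ((N0 + a) * (N0 + b))"
      proof (rule frac_le)
        have B0: "0 \<le> budget P"
          using budget nonneg(1) by (meson mult_nonneg_nonneg of_nat_0_le_iff order_trans)
        show "(\<beta> * real ?T * (real ?T / 2) * (2 * \<eta>)) \<le> budget P * N0 * (a - b)"
          using B0 budget N0 ab nonneg by (intro mult_mono) auto
        show "(N0 + a) * (N0 + b) \<le> (real ?T * H) * (real ?T * H)"
          using tot[OF ab(4)] tot[OF ab(5)] ab N0 HT by (intro mult_mono) (auto simp: add.commute)
        show "0 \<le> budget P * N0 * (a - b)"
          using B0 N0 ab nonneg by simp
        show "0 < (N0 + a) * (N0 + b)"
          using N0 ab by simp
      qed
      finally show ?thesis .
    qed
    ultimately show ?thesis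
      by linarith
  qed
  have "1 / 3 - 2 * measure_pmf.prob (pair_pmf M N) (- G) \<le> measure_pmf.prob (pair_pmf M N) ?W"
    using high low by (intro prob_pair_pmf_two_continuations) (auto simp: N_def)
  also have "\<dots> \<le> measure_pmf.prob (pair_pmf M N)
      (h -` {n. \<beta> * \<eta> / H\<^sup>2 - 2 * l * k * H \<le> waste P X (s, n)})"
    using waste by (intro measure_pmf.finite_measure_mono) (auto simp del: of_nat_sum)
  \<comment> \<open>The two events differ only outside the support.\<close>
  also have "measure_pmf.prob (pair_pmf M N) (- G)
      = measure_pmf.prob (pair_pmf M N) (h -` {n. \<not> envy P X (s, n) \<le> l})"
    by (rule measure_prob_cong_0) (auto simp: G_def pmf_eq_0_set_pmf)
  finally show ?thesis
    by (simp add: law)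
qed

subsection \<open>Averaging over the seed\<close>

text \<open>The observed history ranges over the countable type of lists of naturals, so
  measurability in the seed for each fixed history suffices.\<close>

lemma measurable_allocation:
  assumes "online_algorithm P S X"
  shows "allocation X t \<in> borel_measurable (outcomes P S)"
proof -
  have [measurable]: "(\<lambda>s. X s h) \<in> borel_measurable S" for h
    using assms by (simp add: online_algorithm_def)
  have "(\<lambda>\<omega>. X (fst \<omega>) (map (snd \<omega>) [1..<Suc t])) \<in> borel_measurable (outcomes P S)"
  proof (rule measurable_compose_countable)
    show "(\<lambda>\<omega>. X (fst \<omega>) h) \<in> borel_measurable (outcomes P S)" for h
      unfolding outcomes_def by measurable
    have "(\<lambda>n. map n [1..<Suc t]) \<in> measurable (measure_pmf (arrivals_law P)) (count_space UNIV)"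
      by simp
    then show "(\<lambda>\<omega>. map (snd \<omega>) [1..<Suc t]) \<in> measurable (outcomes P S) (count_space UNIV)"
      unfolding outcomes_def by (rule measurable_compose[OF measurable_snd])
  qed
  then show ?thesis
    by (simp add: allocation_def[abs_def] del: upt_Suc)
qed

lemma measurable_snd_outcomes:
  fixes f :: "(nat \<Rightarrow> nat) \<Rightarrow> real"
  shows "(\<lambda>\<omega>. f (snd \<omega>)) \<in> borel_measurable (outcomes P S)"
  unfolding outcomes_def by (rule measurable_compose[OF measurable_snd]) simp

lemma measurable_waste:
  assumes "online_algorithm P S X"
  shows "waste P X \<in> borel_measurable (outcomes P S)"
proof -
  note [measurable] = measurable_allocation[OF assms] measurable_snd_outcomes
  show ?thesis
    unfolding waste_def[abs_def] spent_def by measurable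
qed

text \<open>With at least one round the maximum is over a nonempty finite set, and the event is a
  finite intersection of measurable ones.\<close>

lemma sets_envy_le:
  assumes "online_algorithm P S X" and "1 \<le> rounds P"
  shows "{\<omega> \<in> space (outcomes P S). envy P X \<omega> \<le> l} \<in> sets (outcomes P S)"
proof -
  note [measurable] = measurable_allocation[OF assms(1)] measurable_snd_outcomes
  have "{\<omega> \<in> space (outcomes P S). envy P X \<omega> \<le> l}
      = {\<omega> \<in> space (outcomes P S).
          \<forall>t\<in>{1..rounds P}. \<bar>allocation X t \<omega> - hindsight_allocation P \<omega>\<bar> \<le> l}"
    using assms(2) by (auto simp: envy_def)
  also have "\<dots> \<in> sets (outcomes P S)"
    unfolding hindsight_allocation_def by measurable
  finally show ?thesis .
qed

lemma measure_pair_eq_integral: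
  assumes "prob_space M" "prob_space N" and A: "A \<in> sets (M \<Otimes>\<^sub>M N)"
  shows "integrable M (\<lambda>x. measure N (Pair x -` A))"
    and "measure (M \<Otimes>\<^sub>M N) A = (\<integral>x. measure N (Pair x -` A) \<partial>M)"
proof -
  interpret M: prob_space M by fact
  interpret N: prob_space N by fact
  interpret MN: pair_prob_space M N ..
  have int: "integrable (M \<Otimes>\<^sub>M N) (indicat_real A)"
    using A by (intro MN.integrable_const_bound[where B = 1]) (auto simp: indicator_def)
  have eq: "(\<integral>y. indicat_real A (x, y) \<partial>N) = measure N (Pair x -` A)" for x
  proof -
    have "(\<integral>y. indicat_real A (x, y) \<partial>N) = (\<integral>y. indicat_real (Pair x -` A) y \<partial>N)"
      by (simp add: indicator_def)
    also have "\<dots> = measure N (Pair x -` A)"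
      using sets_Pair1[OF A, of x] by (simp add: Int_absorb2 sets.sets_into_space)
    finally show ?thesis .
  qed
  show "integrable M (\<lambda>x. measure N (Pair x -` A))"
    using MN.integrable_fst'[OF int] by (simp add: eq)
  have "measure (M \<Otimes>\<^sub>M N) A = (\<integral>\<omega>. indicat_real A \<omega> \<partial>(M \<Otimes>\<^sub>M N))"
    using A by (simp add: Int_absorb2 sets.sets_into_space)
  also have "\<dots> = (\<integral>x. measure N (Pair x -` A) \<partial>M)"
    using MN.integral_fst'[OF int] by (simp add: eq)
  finally show "measure (M \<Otimes>\<^sub>M N) A = (\<integral>x. measure N (Pair x -` A) \<partial>M)" .
qed

text \<open>The inequality for one seed is affine in the probability of large envy, so it survives
  integration over the seed. Feasibility holds for almost every seed by Fubini.\<close>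

lemma prob_waste_ge_of_fixed_seeds:
  fixes p l d \<alpha> :: real
  assumes alg: "online_algorithm P S X" and T: "1 \<le> rounds P"
    and seed: "\<And>s. (AE n in measure_pmf (arrivals_law P). spent P X (s, n) \<le> budget P) \<Longrightarrow>
      p - 2 * measure_pmf.prob (arrivals_law P) {n. \<not> envy P X (s, n) \<le> l}
        \<le> measure_pmf.prob (arrivals_law P) {n. d \<le> waste P X (s, n)}"
    and envy: "1 - \<alpha> \<le> measure (outcomes P S) {\<omega> \<in> space (outcomes P S). envy P X \<omega> \<le> l}"
  shows "p - 2 * \<alpha> \<le> measure (outcomes P S) {\<omega> \<in> space (outcomes P S). d \<le> waste P X \<omega>}"
proof -
  let ?N = "measure_pmf (arrivals_law P)"
  interpret S: prob_space S
    using alg by (simp add: online_algorithm_def)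
  interpret SN: pair_prob_space S ?N ..
  have space: "space S = UNIV"
    using alg sets_eq_imp_space_eq[of S borel] by (simp add: online_algorithm_def)
  have sp: "space (outcomes P S) = UNIV"
    by (simp add: outcomes_def space_pair_measure space)
  let ?G = "{\<omega>. envy P X \<omega> \<le> l}" and ?W = "{\<omega>. d \<le> waste P X \<omega>}"
  have G: "?G \<in> sets (S \<Otimes>\<^sub>M ?N)"
    using sets_envy_le[OF alg T, of l] unfolding sp by (simp add: outcomes_def)
  have W: "?W \<in> sets (S \<Otimes>\<^sub>M ?N)"
    using measurable_sets[OF measurable_waste[OF alg], of "{d..}"] sp
    by (simp add: outcomes_def vimage_def)
  note gi = measure_pair_eq_integral[OF S.prob_space_axioms measure_pmf.prob_space_axioms G]
  note wi = measure_pair_eq_integral[OF S.prob_space_axioms measure_pmf.prob_space_axioms W]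
  have "AE \<omega> in S \<Otimes>\<^sub>M ?N. spent P X \<omega> \<le> budget P"
    using alg unfolding online_algorithm_def outcomes_def by auto
  then have AE: "AE s in S. AE n in ?N. spent P X (s, n) \<le> budget P"
    by (rule SN.AE_pair)
  have "p - 2 * \<alpha> \<le> p - 2 + 2 * measure (S \<Otimes>\<^sub>M ?N) ?G"
    using envy sp by (simp add: outcomes_def)
  also have "\<dots> = (\<integral>s. p - 2 + 2 * measure ?N (Pair s -` ?G) \<partial>S)"
    using gi by (simp add: S.prob_space)
  also have "\<dots> \<le> (\<integral>s. measure ?N (Pair s -` ?W) \<partial>S)"
  proof (rule integral_mono_AE)
    show "AE s in S. p - 2 + 2 * measure ?N (Pair s -` ?G) \<le> measure ?N (Pair s -` ?W)"
      using AE
    proof eventually_elim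
      case (elim s)
      have "measure ?N {n. \<not> envy P X (s, n) \<le> l} = 1 - measure ?N {n. envy P X (s, n) \<le> l}"
        using measure_pmf.prob_neg[of "arrivals_law P" "\<lambda>n. envy P X (s, n) \<le> l"] by simp
      then show ?case
        using seed[OF elim] by (simp add: vimage_def)
    qed
  qed (use gi(1) wi(1) in auto)
  also have "\<dots> = measure (S \<Otimes>\<^sub>M ?N) ?W"
    using wi(2) by simp
  finally show ?thesis
    unfolding sp by (simp add: outcomes_def)
qed

subsection \<open>The lower bound on the waste\<close>

text \<open>As \<open>Phi_inv\<close> is defined by choice, \<open>z\<close> must first be shown to
  be a value of the distribution function. This follows from the intermediate value theorem, since
  the normal law has no atoms; monotonicity then confines \<open>Phi_inv z\<close> to
  \<open>[l, u]\<close>.\<close>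

lemma Phi_inv_bounded:
  assumes "p < 1"
  obtains K where "\<And>z. 1 / 2 < z \<Longrightarrow> z < p \<Longrightarrow> \<bar>Phi_inv z\<bar> \<le> K"
proof -
  let ?N = std_normal_distribution
  interpret real_distribution ?N
    by (rule real_dist_normal_dist)
  have cont: "isCont (cdf ?N) x" for x
  proof -
    have "emeasure ?N {x} = (\<integral>\<^sup>+ z. ennreal (std_normal_density z) * indicator {x} z \<partial>lborel)"
      by (rule emeasure_density) auto
    also have "\<dots> = 0"
      by (subst nn_integral_0_iff_AE) (auto intro!: AE_I[where N = "{x}"])
    finally show ?thesis
      by (simp add: isCont_cdf measure_def)
  qed
  have "\<forall>\<^sub>F x in at_top. p < cdf ?N x"
    using assms cdf_lim_at_top_prob by (rule order_tendstoD(1)[rotated])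
  then obtain u where u: "p < cdf ?N u"
    by (meson eventually_at_top_linorder order_refl)
  have "\<forall>\<^sub>F x in at_bot. cdf ?N x < 1 / 2"
    using cdf_lim_at_bot by (rule order_tendstoD(2)) simp
  then obtain l where l: "cdf ?N l < 1 / 2"
    by (meson eventually_at_bot_linorder order_refl)
  show thesis
  proof
    fix z :: real assume z: "1 / 2 < z" "z < p"
    have "l \<le> u"
      using l u z cdf_nondecreasing[of u l] by linarith
    then have "\<exists>x. l \<le> x \<and> x \<le> u \<and> cdf ?N x = z"
      using l u z cont by (intro IVT) auto
    then have "z \<in> range (cdf ?N)"
      by auto
    then have "cdf ?N (Phi_inv z) = z"
      unfolding Phi_inv_def by (rule f_inv_into_f)
    then have "l \<le> Phi_inv z" "Phi_inv z \<le> u"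
      using l u z cdf_nondecreasing[of "Phi_inv z" l] cdf_nondecreasing[of u "Phi_inv z"] by linarith+
    then show "\<bar>Phi_inv z\<bar> \<le> max \<bar>l\<bar> \<bar>u\<bar>"
      by linarith
  qed
qed

text \<open>Since each round has at least one arrival, the expected total is at least the number of
  rounds, which gives the budget bound. A vanishing \<open>rho_max\<close> would force zero variance
  in round 1.\<close>

lemma valid_problem_parameters:
  assumes "valid_problem P"
  shows "0 < sigma_min P" "0 < rho_max P" "1 \<le> mu_max P" "0 < beta_avg P"
    and "beta_avg P * rounds P \<le> budget P"
    and "\<And>t. t \<in> {1..rounds P} \<Longrightarrow> (sigma_min P)\<^sup>2 \<le> var_arrivals P t"
    and "\<And>t. t \<in> {1..rounds P} \<Longrightarrow>
      AE n in measure_pmf (arrivals P t). \<bar>real n - mean_arrivals P t\<bar> \<le> rho_max P"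
    and "\<And>t n. t \<in> {1..rounds P} \<Longrightarrow> n \<in> set_pmf (arrivals P t) \<Longrightarrow>
      1 \<le> n \<and> real n \<le> mu_max P + rho_max P"
proof -
  let ?R = "{1..rounds P}"
  have T: "1 \<le> rounds P" and B: "0 < budget P"
    using assms by (auto simp: valid_problem_def)
  have vp: "AE n in measure_pmf (arrivals P t). 1 \<le> n"
    "0 < var_arrivals P t"
    "AE n in measure_pmf (arrivals P t). \<bar>real n - mean_arrivals P t\<bar> \<le> deviation P t"
    if "t \<in> ?R" for t
    using assms that unfolding valid_problem_def by blast+
  have ge1: "1 \<le> n" if "t \<in> ?R" "n \<in> set_pmf (arrivals P t)" for t n
    using vp(1)[OF that(1)] that(2) by (simp add: AE_measure_pmf_iff)
  have dev: "\<bar>real n - mean_arrivals P t\<bar> \<le> deviation P t"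
    if "t \<in> ?R" "n \<in> set_pmf (arrivals P t)" for t n
    using vp(3)[OF that(1)] that(2) by (simp add: AE_measure_pmf_iff)
  note var = vp(2)
  have rho: "deviation P t \<le> rho_max P" and mu: "mean_arrivals P t \<le> mu_max P"
    and sig: "sigma_min P \<le> sqrt (var_arrivals P t)" if "t \<in> ?R" for t
    using that by (auto simp: rho_max_def mu_max_def sigma_min_def)
  have "sigma_min P \<in> (\<lambda>t. sqrt (var_arrivals P t)) ` ?R"
    unfolding sigma_min_def using T by (intro Min_in) auto
  then show sig0: "0 < sigma_min P"
    using var by auto
  show "(sigma_min P)\<^sup>2 \<le> var_arrivals P t" if "t \<in> ?R" for t
    using power_mono[OF sig[OF that], of 2] sig0 var[OF that] by simp
  show AE_rho: "AE n in measure_pmf (arrivals P t). \<bar>real n - mean_arrivals P t\<bar> \<le> rho_max P" if "t \<in> ?R" for t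
    using dev[OF that] rho[OF that] by (auto simp: AE_measure_pmf_iff intro: order_trans)
  show "1 \<le> n \<and> real n \<le> mu_max P + rho_max P" if "t \<in> ?R" "n \<in> set_pmf (arrivals P t)" for t n
    using ge1[OF that] dev[OF that] rho[OF that(1)] mu[OF that(1)] by linarith
  have int: "integrable (measure_pmf (arrivals P t)) real" if "t \<in> ?R" for t
  proof (rule measure_pmf.integrable_const_bound[where B = "mu_max P + rho_max P"])
    show "AE n in measure_pmf (arrivals P t). norm (real n) \<le> mu_max P + rho_max P"
      using dev[OF that] rho[OF that] mu[OF that] by (force simp: AE_measure_pmf_iff)
  qed simp
  have mean1: "1 \<le> mean_arrivals P t" if "t \<in> ?R" for t
  proof -
    have "measure_pmf.expectation (arrivals P t) (\<lambda>_. 1) \<le> mean_arrivals P t"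
      unfolding mean_arrivals_def using int[OF that] ge1[OF that]
      by (intro integral_mono_AE) (auto simp: AE_measure_pmf_iff)
    then show ?thesis
      by simp
  qed
  have one: "1 \<in> ?R"
    using T by simp
  show "1 \<le> mu_max P"
    using mean1[OF one] mu[OF one] by linarith
  show "0 < rho_max P"
  proof (rule ccontr)
    assume "\<not> 0 < rho_max P"
    then have "real n = mean_arrivals P 1" if "n \<in> set_pmf (arrivals P 1)" for n
      using dev[OF one that] rho[OF one] by linarith
    then have "AE n in measure_pmf (arrivals P 1). (real n - mean_arrivals P 1)\<^sup>2 = 0"
      by (simp add: AE_measure_pmf_iff)
    then have "var_arrivals P 1 = 0"
      unfolding var_arrivals_def mean_arrivals_def by (rule integral_eq_zero_AE)
    then show False
      using var[OF one] by simp
  qed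
  have comp: "integrable (measure_pmf (arrivals_law P)) (\<lambda>n. real (n t))"
    "measure_pmf.expectation (arrivals_law P) (\<lambda>n. real (n t)) = mean_arrivals P t" if "t \<in> ?R" for t
  proof -
    have eq: "arrivals P t = map_pmf (\<lambda>n. n t) (arrivals_law P)"
      using that by (simp add: arrivals_law_def Pi_pmf_component)
    show "integrable (measure_pmf (arrivals_law P)) (\<lambda>n. real (n t))"
      using int[OF that] unfolding eq by simp
    show "measure_pmf.expectation (arrivals_law P) (\<lambda>n. real (n t)) = mean_arrivals P t"
      unfolding mean_arrivals_def eq by simp
  qed
  have "real (rounds P) = (\<Sum>t\<in>?R. 1)"
    by simp
  also have "\<dots> \<le> (\<Sum>t\<in>?R. mean_arrivals P t)"
    using mean1 by (intro sum_mono)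
  also have "\<dots> = measure_pmf.expectation (arrivals_law P) (total_arrivals P)"
    unfolding total_arrivals_def[abs_def] using comp by (subst Bochner_Integration.integral_sum) auto
  finally have EN: "real (rounds P) \<le> measure_pmf.expectation (arrivals_law P) (total_arrivals P)" .
  then show beta: "0 < beta_avg P"
    using B T by (simp add: beta_avg_def)
  have "budget P = beta_avg P * measure_pmf.expectation (arrivals_law P) (total_arrivals P)"
    using EN T by (auto simp: beta_avg_def)
  then show "beta_avg P * rounds P \<le> budget P"
    using mult_left_mono[OF EN, of "beta_avg P"] beta by simp
qed

section \<open>Choice of the number of final rounds\<close>

lemma min_sqrt_inverse_le_sqrt: "min_sqrt_inverse T l \<le> sqrt T"
  by (simp add: min_sqrt_inverse_def)

lemma min_sqrt_inverse_mult_le: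
  assumes "0 \<le> l"
  shows "l * min_sqrt_inverse T l \<le> 1"
proof (cases "l = 0")
  case False
  then have "l * min (sqrt T) (1 / l) \<le> l * (1 / l)"
    using assms by (intro mult_left_mono) auto
  then show ?thesis
    using False by (simp add: min_sqrt_inverse_def)
qed simp

text \<open>
  The waste is produced in the last \<open>k \<approx> \<kappa> min {T, 1/l\<^sup>2}\<close> rounds, so that the fluctuation
  \<open>c \<surd>k\<close> of their total arrivals, worth \<open>\<beta> c \<surd>k\<close> up to constants, beats the correction \<open>2 l k H\<close>
  that the envy bound leaves to the algorithm.
\<close>

lemma prob_waste_ge:
  fixes \<alpha> \<sigma> \<rho> \<mu> \<beta> :: real and L :: "nat \<Rightarrow> real"
  assumes pos: "0 < \<sigma>" "0 < \<rho>" "1 \<le> \<mu>" "0 < \<beta>" and L: "L \<longlonglongrightarrow> 0" and \<alpha>: "\<alpha> < 1 / 8"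
  obtains D where "0 < D" and "\<forall>\<^sub>F T in sequentially. \<forall>P S X. valid_problem P \<longrightarrow> rounds P = T \<longrightarrow>
    sigma_min P = \<sigma> \<longrightarrow> rho_max P = \<rho> \<longrightarrow> mu_max P = \<mu> \<longrightarrow> beta_avg P = \<beta> \<longrightarrow>
    online_algorithm P S X \<longrightarrow>
    1 - \<alpha> \<le> measure (outcomes P S) {\<omega> \<in> space (outcomes P S). envy P X \<omega> \<le> L T} \<longrightarrow>
    1 / 12 \<le> measure (outcomes P S)
      {\<omega> \<in> space (outcomes P S). D * min_sqrt_inverse T (L T) \<le> waste P X \<omega>} \<and>
    0 < min_sqrt_inverse T (L T)"
proof -
  define H where "H = \<mu> + \<rho>"
  \<comment> \<open>With \<open>\<eta> = c * sqrt k\<close> the ratio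
    \<open>k * \<sigma>\<^sup>2 / (2 * \<eta>\<^sup>2)\<close> is 800, and
    \<open>1 / sqrt 801\<close> is below 1/24.\<close>
  define c where "c = \<sigma> / 40"
  \<comment> \<open>The first entry ensures \<open>2 * k \<le> T\<close>; the second keeps the envy
    correction below half of the main term.\<close>
  define \<kappa> where "\<kappa> = min (1 / 2) ((\<beta> * c / (4 * H ^ 3))\<^sup>2)"
  \<comment> \<open>From \<open>k \<ge> K\<close> follows
    \<open>(\<rho> / \<eta>)\<^sup>2 \<le> 1 / 24\<close>.\<close>
  define K where "K = max 1 (24 * \<rho>\<^sup>2 / c\<^sup>2)"
  define R where "R = sqrt ((K + 1) / \<kappa>)"
  define D where "D = sqrt (\<kappa> / 2) * (\<beta> * c / (2 * H\<^sup>2))"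
  have H: "0 < H" and c: "0 < c" and K: "1 \<le> K"
    using pos by (auto simp: H_def c_def K_def)
  have kap: "0 < \<kappa>" "\<kappa> \<le> 1 / 2" "sqrt \<kappa> \<le> \<beta> * c / (4 * H ^ 3)"
  proof -
    have q: "0 < \<beta> * c / (4 * H ^ 3)"
      using H c pos by simp
    then have "0 < (\<beta> * c / (4 * H ^ 3))\<^sup>2"
      by (rule zero_less_power)
    then show "0 < \<kappa>"
      unfolding \<kappa>_def min_less_iff_conj by simp
    show "\<kappa> \<le> 1 / 2"
      by (simp add: \<kappa>_def)
    have "sqrt \<kappa> \<le> sqrt ((\<beta> * c / (4 * H ^ 3))\<^sup>2)"
      unfolding \<kappa>_def by (rule real_sqrt_le_mono) (rule min.cobounded2)
    then show "sqrt \<kappa> \<le> \<beta> * c / (4 * H ^ 3)"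
      using q by (simp add: real_sqrt_abs del: real_sqrt_le_iff)
  qed
  have R: "0 < R" "\<kappa> * R\<^sup>2 = K + 1"
    using kap K by (auto simp: R_def)
  have D: "0 < D"
    using kap H c pos by (simp add: D_def)
  have "\<forall>\<^sub>F T in sequentially. \<bar>L T\<bar> < 1 / R"
    using L tendsto_rabs_zero R(1) by (intro order_tendstoD(2)[of "\<lambda>T. \<bar>L T\<bar>" 0]) auto
  moreover have "\<forall>\<^sub>F T in sequentially. R \<le> sqrt (real T)"
    by (rule filterlim_at_top[THEN iffD1, rule_format]) real_asymp
  ultimately have "\<forall>\<^sub>F T in sequentially. \<forall>P S X. valid_problem P \<longrightarrow> rounds P = T \<longrightarrow>
    sigma_min P = \<sigma> \<longrightarrow> rho_max P = \<rho> \<longrightarrow> mu_max P = \<mu> \<longrightarrow> beta_avg P = \<beta> \<longrightarrow>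
    online_algorithm P S X \<longrightarrow>
    1 - \<alpha> \<le> measure (outcomes P S) {\<omega> \<in> space (outcomes P S). envy P X \<omega> \<le> L T} \<longrightarrow>
    1 / 12 \<le> measure (outcomes P S)
      {\<omega> \<in> space (outcomes P S). D * min_sqrt_inverse T (L T) \<le> waste P X \<omega>} \<and>
    0 < min_sqrt_inverse T (L T)"
  proof eventually_elim
    case (elim T)
    show ?case
    proof (intro allI impI)
      fix P S X
      assume P: "valid_problem P" and T: "rounds P = T"
        and par: "sigma_min P = \<sigma>" "rho_max P = \<rho>" "mu_max P = \<mu>" "beta_avg P = \<beta>"
        and alg: "online_algorithm P S X"
        and envy: "1 - \<alpha> \<le> measure (outcomes P S) {\<omega> \<in> space (outcomes P S). envy P X \<omega> \<le> L T}"
      note valid = valid_problem_parameters[OF P, unfolded par T]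
      have T1: "1 \<le> rounds P"
        using P by (simp add: valid_problem_def)
      define l where "l = L T"
      define M where "M = min_sqrt_inverse T l"
      \<comment> \<open>A negative bound would make the envy event empty, against its probability of
        at least \<open>1 - \<alpha> > 0\<close>.\<close>
      have l: "0 \<le> l"
      proof (rule ccontr)
        assume neg: "\<not> 0 \<le> l"
        have "\<not> envy P X \<omega> \<le> l" for \<omega>
          using envy_leD[of P X \<omega> l 1] neg T1 by force
        then have "{\<omega> \<in> space (outcomes P S). envy P X \<omega> \<le> L T} = {}"
          by (auto simp: l_def)
        then show False
          using envy \<alpha> by (simp del: Collect_empty_eq)
      qed
      have M: "R \<le> M" "l * M \<le> 1" "M \<le> sqrt T"
      proof -
        show "l * M \<le> 1" "M \<le> sqrt T"
          unfolding M_def using min_sqrt_inverse_mult_le[OF l] min_sqrt_inverse_le_sqrt by auto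
        have "R \<le> 1 / l" if "l \<noteq> 0"
          using elim(1) that l R(1) by (simp add: l_def field_simps)
        then show "R \<le> M"
          using elim(2) by (simp add: M_def min_sqrt_inverse_def)
      qed
      define k where "k = nat \<lfloor>\<kappa> * M\<^sup>2\<rfloor>"
      \<comment> \<open>The extra 1 pays for the floor in \<open>k\<close>, so that
        \<open>k \<ge> K\<close>; as \<open>K \<ge> 1\<close>, also
        \<open>k \<ge> \<kappa> / 2 * M\<^sup>2\<close>.\<close>
      have KM: "K + 1 \<le> \<kappa> * M\<^sup>2"
        using R(2) kap(1) power_mono[OF M(1), of 2] R(1) mult_left_mono[of "R\<^sup>2" "M\<^sup>2" \<kappa>] by simp
      then have "0 \<le> \<lfloor>\<kappa> * M\<^sup>2\<rfloor>"
        using K by linarith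
      then have "real k = of_int \<lfloor>\<kappa> * M\<^sup>2\<rfloor>"
        by (simp add: k_def)
      then have k: "real k \<le> \<kappa> * M\<^sup>2" "\<kappa> * M\<^sup>2 - 1 \<le> real k"
        by linarith+
      have kK: "K \<le> real k" and k2: "\<kappa> / 2 * M\<^sup>2 \<le> real k"
        using k KM K by linarith+
      have k0: "0 < real k"
        using kK K by linarith
      have "M\<^sup>2 \<le> real T"
        using power_mono[OF M(3), of 2] R(1) M(1) by simp
      then have "\<kappa> * M\<^sup>2 \<le> 1 / 2 * real T"
        using kap by (intro mult_mono) auto
      then have kT: "2 * k \<le> rounds P"
        using k(1) T by linarith
      define \<eta> where "\<eta> = c * sqrt k"
      have eta: "0 < \<eta>" "\<eta>\<^sup>2 = c\<^sup>2 * k"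
        using c k0 by (auto simp: \<eta>_def power_mult_distrib)
      define J where "J = {rounds P - k + 1..rounds P}"
      have J: "finite J" "card J = k" "J \<subseteq> {1..rounds P}"
        using kT by (auto simp: J_def)
      \<comment> \<open>Both terms in the bracket are at most 1/24, and 2 (1/24 + 1/24) = 1/6 is
        exactly the window that leaves 1/3 on either side of the median.\<close>
      have conc: "2 * (1 / sqrt (1 + real (card J) * \<sigma>\<^sup>2 / (2 * \<eta>\<^sup>2)) + (\<rho> / \<eta>)\<^sup>2) \<le> 1 / 2 - 1 / 3"
      proof -
        have "real (card J) * \<sigma>\<^sup>2 / (2 * \<eta>\<^sup>2) = 800"
          using k0 pos(1) by (simp add: eta J(2) c_def field_simps)
        then have "1 / sqrt (1 + real (card J) * \<sigma>\<^sup>2 / (2 * \<eta>\<^sup>2)) \<le> 1 / 24"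
          by (simp add: real_le_rsqrt field_simps)
        moreover have "(\<rho> / \<eta>)\<^sup>2 \<le> 1 / 24"
        proof -
          have "24 * \<rho>\<^sup>2 / c\<^sup>2 \<le> real k"
            using kK by (simp add: K_def)
          then show ?thesis
            using c k0 by (simp add: power_divide eta field_simps)
        qed
        moreover have "2 * (x + y) \<le> 1 / 2 - 1 / 3" if "x \<le> 1 / 24" "y \<le> 1 / 24" for x y :: real
          using that by simp
        ultimately show ?thesis
          by blast
      qed
      let ?N = "Pi_pmf J 0 (arrivals P)"
      have "measure_pmf.prob ?N {g \<in> space (measure_pmf ?N). \<bar>real (\<Sum>t\<in>J. g t) - x\<bar> \<le> \<eta>} \<le> 1 / 2 - 1 / 3"
        for x
      proof -
        have "measure_pmf.prob ?N {g. \<bar>real (\<Sum>t\<in>J. g t) - x\<bar> \<le> \<eta>}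
            \<le> 2 * (1 / sqrt (1 + real (card J) * \<sigma>\<^sup>2 / (2 * \<eta>\<^sup>2)) + (\<rho> / \<eta>)\<^sup>2)"
          using valid(6,7) J(3) T pos(2) eta(1)
          by (intro Pi_pmf_sum_near_le J(1)) (auto simp: var_arrivals_def mean_arrivals_def)
        then show ?thesis
          using conc by simp
      qed
      then obtain m where m:
        "1 / 3 \<le> measure_pmf.prob ?N {g \<in> space (measure_pmf ?N). real (\<Sum>t\<in>J. g t) > m + \<eta>}"
        "1 / 3 \<le> measure_pmf.prob ?N {g \<in> space (measure_pmf ?N). real (\<Sum>t\<in>J. g t) < m - \<eta>}"
        by (rule measure_pmf.spread_around_median[rotated]) auto
      define d where "d = \<beta> * \<eta> / H\<^sup>2 - 2 * l * k * H"
      \<comment> \<open>By \<open>l * M \<le> 1\<close> and the choice of \<open>\<kappa>\<close>,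
        the envy correction takes at most half of the main term
        \<open>\<beta> * \<eta> / H\<^sup>2\<close>; the other half is at least
        \<open>D * M\<close>.\<close>
      have "D * M \<le> d"
      proof -
        have "l * sqrt k \<le> l * sqrt (\<kappa> * M\<^sup>2)"
          using k(1) l by (intro mult_left_mono) auto
        also have "\<dots> = sqrt \<kappa> * (l * M)"
          using M(1) R(1) by (simp add: real_sqrt_mult)
        also have "\<dots> \<le> sqrt \<kappa> * 1"
          using M(2) kap by (intro mult_left_mono) auto
        finally have lk: "l * sqrt k \<le> \<beta> * c / (4 * H ^ 3)"
          using kap(3) by linarith
        have "2 * H * (l * sqrt k) \<le> 2 * H * (\<beta> * c / (4 * H ^ 3))"
          using lk H by (intro mult_left_mono) auto
        also have "\<dots> = \<beta> * c / (2 * H\<^sup>2)"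
          using H by (simp add: power2_eq_square power3_eq_cube)
        finally have "\<beta> * c / (2 * H\<^sup>2) \<le> \<beta> * c / H\<^sup>2 - 2 * H * (l * sqrt k)"
          by (simp add: field_simps)
        then have *: "sqrt k * (\<beta> * c / (2 * H\<^sup>2)) \<le> sqrt k * (\<beta> * c / H\<^sup>2 - 2 * H * (l * sqrt k))"
          by (intro mult_left_mono) auto
        have "sqrt (\<kappa> / 2) * M = sqrt (\<kappa> / 2 * M\<^sup>2)"
          using M(1) R(1) unfolding real_sqrt_mult[of "\<kappa> / 2"] by simp
        also have "\<dots> \<le> sqrt k"
          using k2 by simp
        finally have "sqrt (\<kappa> / 2) * M * (\<beta> * c / (2 * H\<^sup>2)) \<le> sqrt k * (\<beta> * c / (2 * H\<^sup>2))"
          using pos(4) c by (intro mult_right_mono) auto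
        also note *
        also have "sqrt k * (\<beta> * c / H\<^sup>2 - 2 * H * (l * sqrt k)) = d"
        proof -
          have "sqrt k * (2 * H * (l * sqrt k)) = 2 * l * (sqrt k * sqrt k) * H"
            by (simp only: ac_simps)
          then show ?thesis
            by (simp add: d_def \<eta>_def right_diff_distrib mult_ac)
        qed
        finally show ?thesis
          by (simp add: D_def mult_ac)
      qed
      have "1 / 12 \<le> 1 / 3 - 2 * \<alpha>"
        using \<alpha> by simp
      also have "\<dots> \<le> measure (outcomes P S) {\<omega> \<in> space (outcomes P S). d \<le> waste P X \<omega>}"
      proof (rule prob_waste_ge_of_fixed_seeds[OF alg T1 _ envy])
        fix s
        assume "AE n in measure_pmf (arrivals_law P). spent P X (s, n) \<le> budget P"
        then show "1 / 3 - 2 * measure_pmf.prob (arrivals_law P) {n. \<not> envy P X (s, n) \<le> L T}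
          \<le> measure_pmf.prob (arrivals_law P) {n. d \<le> waste P X (s, n)}"
          unfolding d_def l_def[symmetric]
          using kT T1 valid(5,8) T pos(4) l eta(1) m
          by (intro prob_waste_ge_fixed_seed[OF _ _ _ _ _ _ _ _ J_def]) (auto simp: H_def)
      qed
      also have "\<dots> \<le> measure (outcomes P S) {\<omega> \<in> space (outcomes P S). D * M \<le> waste P X \<omega>}"
      proof -
        interpret prob_space "outcomes P S"
          using alg unfolding outcomes_def online_algorithm_def
          by (intro prob_space_pair measure_pmf.prob_space_axioms) auto
        note [measurable] = measurable_waste[OF alg]
        show ?thesis
          using \<open>D * M \<le> d\<close> by (intro finite_measure_mono) auto
      qed
      finally show "1 / 12 \<le> measure (outcomes P S)
          {\<omega> \<in> space (outcomes P S). D * min_sqrt_inverse T (L T) \<le> waste P X \<omega>} \<and>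
        0 < min_sqrt_inverse T (L T)"
        using M(1) R(1) by (simp add: M_def l_def)
    qed
  qed
  with D show thesis
    by (rule that)
qed

text \<open>\<open>Phi_inv\<close> is bounded on the whole interval while the root of the logarithm
  in the denominator diverges. Uniformity in \<open>z\<close> matters because the argument used
  later varies with \<open>T\<close>.\<close>

lemma waste_coeff_eventually_le:
  assumes \<alpha>: "0 < \<alpha>" and pos: "0 < \<rho>" "0 < \<mu>" "0 < D"
  shows "\<forall>\<^sub>F T in sequentially. \<forall>z. 1 / 2 < z \<and> z < 1 - 3 * \<alpha> \<longrightarrow>
    waste_coeff T \<alpha> \<sigma> \<rho> \<mu> \<beta> z 0 \<le> D"
proof -
  obtain K where K: "\<And>z. 1 / 2 < z \<Longrightarrow> z < 1 - 3 * \<alpha> \<Longrightarrow> \<bar>Phi_inv z\<bar> \<le> K"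
    using Phi_inv_bounded[of "1 - 3 * \<alpha>"] \<alpha> by auto
  let ?g = "\<lambda>T. \<beta>\<^sup>2 * (K\<^sup>2 * \<sigma>\<^sup>2 / (24 * sqrt (2 * \<rho>\<^sup>2 * ln (real T / \<alpha>)) * \<mu>))"
  have "?g \<longlonglongrightarrow> 0"
    using \<alpha> pos by real_asymp
  then have "\<forall>\<^sub>F T in sequentially. ?g T < D"
    using pos(3) by (rule order_tendstoD(2))
  moreover have "\<forall>\<^sub>F T in sequentially. 0 \<le> ln (real T / \<alpha>)"
    using \<alpha> by real_asymp
  ultimately show ?thesis
  proof eventually_elim
    case (elim T)
    have "waste_coeff T \<alpha> \<sigma> \<rho> \<mu> \<beta> z 0 \<le> ?g T" if z: "1 / 2 < z" "z < 1 - 3 * \<alpha>" for z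
    proof -
      have "(Phi_inv z)\<^sup>2 \<le> K\<^sup>2"
        using K[OF z] by (meson abs_ge_self abs_le_square_iff order_trans)
      then show ?thesis
        unfolding waste_coeff_def using elim(2) pos
        by (auto intro!: mult_left_mono divide_right_mono mult_right_mono)
    qed
    with elim(1) show ?case
      by (meson less_imp_le order_trans)
  qed
qed

theorem theorem4p2:
  shows "\<exists>C>0::real. \<forall>(\<alpha>::real) (\<sigma>::real) (\<rho>::real) (\<mu>::real) (\<beta>::real) (L :: nat \<Rightarrow> real).
     0 < \<alpha> \<and> \<alpha> < 1 / 8 \<and> L \<longlonglongrightarrow> 0 \<longrightarrow>
     (\<exists>e1 e2 :: nat \<Rightarrow> real. e1 \<longlonglongrightarrow> 0 \<and> e2 \<longlonglongrightarrow> 0 \<and>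
       (\<forall>T P S X.
          valid_problem P \<and> rounds P = T \<and>
          sigma_min P = \<sigma> \<and> rho_max P = \<rho> \<and> mu_max P = \<mu> \<and> beta_avg P = \<beta> \<and>
          3 * \<alpha> + C * \<rho> / (\<sigma> ^ 3 * sqrt (real T)) < 1 / 2 \<and>
          online_algorithm P S X \<and>
          measure (outcomes P S) {\<omega> \<in> space (outcomes P S). envy P X \<omega> \<le> L T} \<ge> 1 - \<alpha>
          \<longrightarrow>
          measure (outcomes P S)
            {\<omega> \<in> space (outcomes P S).
               waste P X \<omega> \<ge>
                 waste_coeff T \<alpha> \<sigma> \<rho> \<mu> \<beta> (1 - 3 * \<alpha> - C * \<rho> / (\<sigma> ^ 3 * sqrt (real T))) (e1 T)
                 * min_sqrt_inverse T (L T)}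
          \<ge> 1 / 12 - e2 T))"
proof (rule exI[of _ 1], intro conjI allI impI)
  fix \<alpha> \<sigma> \<rho> \<mu> \<beta> :: real and L :: "nat \<Rightarrow> real"
  assume asm: "0 < \<alpha> \<and> \<alpha> < 1 / 8 \<and> L \<longlonglongrightarrow> 0"
  \<comment> \<open>The constant C is 1. The subtracted term is positive for T > 0, and the
    hypothesis keeps it below \<open>1 / 2 - 3 * \<alpha>\<close>, so \<open>?z T\<close> lies
    strictly between 1/2 and \<open>1 - 3 * \<alpha>\<close>.\<close>
  let ?z = "\<lambda>T. 1 - 3 * \<alpha> - 1 * \<rho> / (\<sigma> ^ 3 * sqrt (real T))"
  let ?hyp = "\<lambda>T P S X. valid_problem P \<and> rounds P = T \<and>
          sigma_min P = \<sigma> \<and> rho_max P = \<rho> \<and> mu_max P = \<mu> \<and> beta_avg P = \<beta> \<and>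
          3 * \<alpha> + 1 * \<rho> / (\<sigma> ^ 3 * sqrt (real T)) < 1 / 2 \<and>
          online_algorithm P S X \<and>
          measure (outcomes P S) {\<omega> \<in> space (outcomes P S). envy P X \<omega> \<le> L T} \<ge> 1 - \<alpha>"
  let ?prob = "\<lambda>T P S X. measure (outcomes P S) {\<omega> \<in> space (outcomes P S).
          waste P X \<omega> \<ge> waste_coeff T \<alpha> \<sigma> \<rho> \<mu> \<beta> (?z T) 0 * min_sqrt_inverse T (L T)}"
  have "\<exists>T0. \<forall>T\<ge>T0. \<forall>P S X. ?hyp T P S X \<longrightarrow> 1 / 12 \<le> ?prob T P S X"
  proof (cases "0 < \<sigma> \<and> 0 < \<rho> \<and> 1 \<le> \<mu> \<and> 0 < \<beta>")
    \<comment> \<open>No valid problem has such parameters, so \<open>?hyp\<close> is never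
      met.\<close>
    case False
    then show ?thesis
      using valid_problem_parameters(1-4) by blast
  next
    case True
    then have pos: "0 < \<sigma>" "0 < \<rho>" "1 \<le> \<mu>" "0 < \<beta>"
      by auto
    from asm have L: "L \<longlonglongrightarrow> 0" and \<alpha>: "0 < \<alpha>" "\<alpha> < 1 / 8"
      by auto
    obtain D where D: "0 < D" and ev: "\<forall>\<^sub>F T in sequentially. \<forall>P S X. valid_problem P \<longrightarrow> rounds P = T \<longrightarrow>
      sigma_min P = \<sigma> \<longrightarrow> rho_max P = \<rho> \<longrightarrow> mu_max P = \<mu> \<longrightarrow> beta_avg P = \<beta> \<longrightarrow>
      online_algorithm P S X \<longrightarrow>
      1 - \<alpha> \<le> measure (outcomes P S) {\<omega> \<in> space (outcomes P S). envy P X \<omega> \<le> L T} \<longrightarrow>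
      1 / 12 \<le> measure (outcomes P S)
        {\<omega> \<in> space (outcomes P S). D * min_sqrt_inverse T (L T) \<le> waste P X \<omega>} \<and>
      0 < min_sqrt_inverse T (L T)"
      using prob_waste_ge[OF pos L \<alpha>(2)] by blast
    have "0 < \<mu>"
      using pos(3) by simp
    from ev waste_coeff_eventually_le[OF \<alpha>(1) pos(2) this D, of \<sigma> \<beta>] eventually_gt_at_top[of 0]
    have "\<forall>\<^sub>F T in sequentially. \<forall>P S X. ?hyp T P S X \<longrightarrow> 1 / 12 \<le> ?prob T P S X"
    proof eventually_elim
      case (elim T)
      show ?case
      proof (intro allI impI)
        fix P S X
        assume hyp: "?hyp T P S X"
        then have D12: "1 / 12 \<le> measure (outcomes P S)
            {\<omega> \<in> space (outcomes P S). D * min_sqrt_inverse T (L T) \<le> waste P X \<omega>}"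
          and M: "0 < min_sqrt_inverse T (L T)"
          using elim(1) by blast+
        have "0 < 1 * \<rho> / (\<sigma> ^ 3 * sqrt (real T))"
          using pos elim(3) by simp
        then have "waste_coeff T \<alpha> \<sigma> \<rho> \<mu> \<beta> (?z T) 0 \<le> D"
          using hyp by (intro elim(2)[rule_format]) linarith
        then have le: "waste_coeff T \<alpha> \<sigma> \<rho> \<mu> \<beta> (?z T) 0 * min_sqrt_inverse T (L T)
            \<le> D * min_sqrt_inverse T (L T)"
          using M by (intro mult_right_mono) auto
        have alg: "online_algorithm P S X"
          using hyp by blast
        interpret prob_space "outcomes P S"
          using alg unfolding outcomes_def online_algorithm_def
          by (intro prob_space_pair measure_pmf.prob_space_axioms) auto
        note [measurable] = measurable_waste[OF alg]
        note D12
        also have "measure (outcomes P S)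
            {\<omega> \<in> space (outcomes P S). D * min_sqrt_inverse T (L T) \<le> waste P X \<omega>} \<le> ?prob T P S X"
          using le by (intro finite_measure_mono) (auto intro: order_trans)
        finally show "1 / 12 \<le> ?prob T P S X" .
      qed
    qed
    then show ?thesis
      by (simp only: eventually_sequentially)
  qed
  then obtain T0 where T0: "\<And>T P S X. T0 \<le> T \<Longrightarrow> ?hyp T P S X \<Longrightarrow> 1 / 12 \<le> ?prob T P S X"
    by blast
  define e2 :: "nat \<Rightarrow> real" where "e2 T = (if T < T0 then 1 else 0)" for T
  have "e2 \<longlonglongrightarrow> 0"
  proof (rule tendsto_eventually)
    show "\<forall>\<^sub>F T in sequentially. e2 T = 0"
      using eventually_ge_at_top[of T0] by eventually_elim (simp add: e2_def)
  qed
  moreover have "1 / 12 - e2 T \<le> ?prob T P S X" if "?hyp T P S X" for T P S X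
  proof (cases "T < T0")
    case True
    then have "1 / 12 - e2 T \<le> 0"
      by (simp add: e2_def)
    then show ?thesis
      using measure_nonneg order_trans by blast
  next
    case False
    then show ?thesis
      using T0[OF _ that] by (simp add: e2_def)
  qed
  ultimately show "\<exists>e1 e2 :: nat \<Rightarrow> real. e1 \<longlonglongrightarrow> 0 \<and> e2 \<longlonglongrightarrow> 0 \<and>
       (\<forall>T P S X. ?hyp T P S X \<longrightarrow>
          measure (outcomes P S)
            {\<omega> \<in> space (outcomes P S).
               waste P X \<omega> \<ge> waste_coeff T \<alpha> \<sigma> \<rho> \<mu> \<beta> (?z T) (e1 T) * min_sqrt_inverse T (L T)}
          \<ge> 1 / 12 - e2 T)"
    by (intro exI[of _ "\<lambda>_. 0"] exI[of _ e2]) auto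
qed simp

end
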